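(* Let $(\sigma_n)_{n=1}^\infty$ be an increasing sequence of positive integers with $\sigma_{n+1}-\sigma_n\ge n$ for all $n\ge1$ and such that the limit \[\beta:=\lim_{n\to\infty}\frac{\sigma_{n+1}-\sigma_n}{n}\] exists in $[1,\infty]$. Define \[G((\sigma_n)_{n=1}^\infty)=\{x\in J\colon a_{\sigma_n}(x),\ldots,a_{\sigma_n+n-1}(x)\ \text{is an arithmetic progression for all sufficiently large}\ n\}.\] Then \[\dim_{\rm H} G((\sigma_n)_{n=1}^\infty)=\begin{cases}\dfrac{\beta-1}{2\beta}&\text{if }\beta<\infty,\\ 1/2&\text{otherwise.}\end{cases}\]
   Context: Every irrational $x\in(0,1)$ has a regular continued fraction expansion $x=\cfrac{1}{a_1(x)+\cfrac{1}{a_2(x)+\cdots}}$ with partial quotients $a_n(x)\in\mathbb N$. $J=\{x\in(0,1)\setminus\mathbb Q\colon a_n(x)<a_{n+1}(x)\text{ for every }n\ge1\}$. $\dim_{\rm H}$ denotes Hausdorff dimension in $[0,1]$ with the Euclidean metric. *)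

theory Defs
  imports "HOL-Analysis.Analysis"
begin

definition gauss_map :: "real \<Rightarrow> real" where
  "gauss_map x = frac (1 / x)"

text \<open>Partial quotients a_n(x), n \<ge> 1: a_n(x) = floor(1 / T^(n-1)(x)).
  (The value for n = 0 is irrelevant and never used.)\<close>
definition cf_a :: "nat \<Rightarrow> real \<Rightarrow> nat" where
  "cf_a n x = nat \<lfloor>1 / ((gauss_map ^^ (n - 1)) x)\<rfloor>"

definition J_set :: "real set" where
  "J_set = {x. 0 < x \<and> x < 1 \<and> x \<notin> \<rat> \<and> (\<forall>n\<ge>1. cf_a n x < cf_a (Suc n) x)}"

definition cf_block_AP :: "real \<Rightarrow> nat \<Rightarrow> nat \<Rightarrow> bool" where
  "cf_block_AP x m n \<longleftrightarrow>
     (\<forall>i. i + 1 < n \<longrightarrow>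
        int (cf_a (m + i + 1) x) - int (cf_a (m + i) x) = int (cf_a (m + 1) x) - int (cf_a m x))"

definition G_set :: "(nat \<Rightarrow> nat) \<Rightarrow> real set" where
  "G_set \<sigma> = {x \<in> J_set. \<exists>N. \<forall>n\<ge>N. cf_block_AP x (\<sigma> n) n}"

text \<open>diam(U)^s with the usual conventions: the empty set contributes 0 and
  0^0 = 1 (so H^0 is the counting measure).\<close>
definition diam_pow :: "real \<Rightarrow> real set \<Rightarrow> real" where
  "diam_pow s U = (if U = {} then 0
                   else if diameter U = 0 then (if s = 0 then 1 else 0)
                   else diameter U powr s)"

definition hausdorff_content :: "real \<Rightarrow> real \<Rightarrow> real set \<Rightarrow> ennreal" where
  "hausdorff_content \<delta> s E =
     (INF U \<in> {U :: nat \<Rightarrow> real set. E \<subseteq> (\<Union>i. U i) \<and> (\<forall>i. bounded (U i) \<and> diameter (U i) \<le> \<delta>)}.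
        (\<Sum>i. ennreal (diam_pow s (U i))))"

definition hausdorff_measure :: "real \<Rightarrow> real set \<Rightarrow> ennreal" where
  "hausdorff_measure s E = (SUP \<delta> \<in> {0<..}. hausdorff_content \<delta> s E)"

definition hausdorff_dim :: "real set \<Rightarrow> real" where
  "hausdorff_dim E = Inf {s. s \<ge> 0 \<and> hausdorff_measure s E = 0}"

end

theory Submission
  imports Defs "HOL-Real_Asymp.Real_Asymp"
begin

text \<open>
  Put \<open>\<theta> = 1 / \<beta>\<close>, the asymptotic density of the positions in progressions; the dimension is
  \<open>(1 - \<theta>) / 2\<close>.

  Upper bound. On digits \<open>a\<^sub>1, \<dots>, a\<^sub>n\<close> the inverse branch of the Gauss map contracts distances by at
  least the factor \<open>\<Prod> 1 / a\<^sub>i\<^sup>2\<close>. Since the digits increase, every digit of a progression dominates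
  all free digits before it, so the \<open>n\<close> progression digits can be traded against the roughly
  \<open>(\<beta> - 1) n\<close> preceding free ones: each free digit \<open>f\<close> then carries a weight about
  \<open>f powr (- 2 s / (1 - \<theta>))\<close>, which is summable when \<open>s > (1 - \<theta>) / 2\<close>. The two parameters of a
  progression cost only boundedly many of its digits.

  Lower bound. Let the free digit at position \<open>i\<close> range over an interval of \<open>i ^ (L - 1)\<close> integers
  above \<open>i ^ L\<close> and fix all progressions. Reading the free digits as mixed radix digits maps
  \<open>[0, 1)\<close> into this set by a map whose inverse is \<open>s\<close>-Hoelder for every
  \<open>s < (1 - 1 / L) (1 - \<theta>) / 2\<close>, so the set has positive \<open>s\<close>-dimensional content.
\<close>

section \<open>The Gauss map and partial quotients\<close>

definition irr01 :: "real set" where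
  "irr01 = {x. 0 < x \<and> x < 1 \<and> x \<notin> \<rat>}"

lemma irr01_bounds: "x \<in> irr01 \<Longrightarrow> 0 < x" "x \<in> irr01 \<Longrightarrow> x < 1"
  by (auto simp: irr01_def)

lemma gauss_map_irr01:
  assumes "x \<in> irr01" shows "gauss_map x \<in> irr01"
proof -
  have "gauss_map x \<notin> \<rat>"
  proof
    assume "gauss_map x \<in> \<rat>"
    then have "gauss_map x + of_int \<lfloor>1 / x\<rfloor> \<in> \<rat>" by (intro Rats_add) auto
    then have "1 / x \<in> \<rat>" by (simp add: gauss_map_def frac_def)
    then have "1 / (1 / x) \<in> \<rat>" by (rule Rats_divide[OF Rats_1])
    with assms show False by (simp add: irr01_def)
  qed
  moreover from this have "gauss_map x \<noteq> 0" by (metis Rats_0)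
  ultimately show ?thesis
    using frac_ge_0[of "1 / x"] frac_lt_1[of "1 / x"] by (auto simp: irr01_def gauss_map_def)
qed

lemma gauss_map_funpow_irr01: "x \<in> irr01 \<Longrightarrow> (gauss_map ^^ n) x \<in> irr01"
  by (induction n) (auto simp: gauss_map_irr01)

definition cf_digit :: "real \<Rightarrow> nat \<Rightarrow> nat" where
  "cf_digit x n = nat \<lfloor>1 / (gauss_map ^^ n) x\<rfloor>"

lemma cf_a_Suc: "cf_a (Suc n) x = cf_digit x n"
  by (simp add: cf_a_def cf_digit_def)

lemma cf_digit_gauss_map_funpow: "cf_digit ((gauss_map ^^ m) x) n = cf_digit x (m + n)"
  by (simp add: cf_digit_def funpow_add add.commute[of m n])

lemma one_div_gauss_map_funpow:
  assumes "x \<in> irr01"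
  shows "1 / (gauss_map ^^ n) x = real (cf_digit x n) + (gauss_map ^^ Suc n) x"
  using irr01_bounds[OF gauss_map_funpow_irr01[OF assms, of n]]
  by (simp add: cf_digit_def gauss_map_def frac_def)

lemma cf_digit_ge_1: "x \<in> irr01 \<Longrightarrow> 1 \<le> cf_digit x n"
  using irr01_bounds[OF gauss_map_funpow_irr01[of x n]] by (simp add: cf_digit_def le_nat_iff)

lemma gauss_map_funpow_le:
  assumes "x \<in> irr01" shows "(gauss_map ^^ n) x \<le> 1 / real (cf_digit x n)"
proof -
  have "1 / (gauss_map ^^ n) x \<ge> real (cf_digit x n)"
    using one_div_gauss_map_funpow[OF assms, of n]
      irr01_bounds(1)[OF gauss_map_funpow_irr01[OF assms, of "Suc n"]] by linarith
  then show ?thesis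
    using cf_digit_ge_1[OF assms, of n] irr01_bounds(1)[OF gauss_map_funpow_irr01[OF assms, of n]]
    by (simp add: field_simps)
qed

lemma gauss_map_funpow_ge:
  assumes "x \<in> irr01" shows "1 / (real (cf_digit x n) + 1) \<le> (gauss_map ^^ n) x"
proof -
  have "1 / (gauss_map ^^ n) x \<le> real (cf_digit x n) + 1"
    using one_div_gauss_map_funpow[OF assms, of n]
      irr01_bounds(2)[OF gauss_map_funpow_irr01[OF assms, of "Suc n"]] by linarith
  then show ?thesis
    using irr01_bounds(1)[OF gauss_map_funpow_irr01[OF assms, of n]] by (simp add: field_simps)
qed

lemma gauss_map_funpow_dist:
  assumes x: "x \<in> irr01" and y: "y \<in> irr01"
    and agree: "\<And>i. i < n \<Longrightarrow> cf_digit x i = cf_digit y i"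
  shows "\<bar>x - y\<bar> = \<bar>(gauss_map ^^ n) x - (gauss_map ^^ n) y\<bar> *
    (\<Prod>i<n. (gauss_map ^^ i) x * (gauss_map ^^ i) y)"
  using agree
proof (induction n)
  case (Suc n)
  define u v where "u = (gauss_map ^^ n) x" and "v = (gauss_map ^^ n) y"
  have uv: "u > 0" "v > 0"
    unfolding u_def v_def using x y by (auto intro: irr01_bounds gauss_map_funpow_irr01)
  have "(gauss_map ^^ Suc n) x - (gauss_map ^^ Suc n) y = 1 / u - 1 / v"
    using one_div_gauss_map_funpow[OF x, of n] one_div_gauss_map_funpow[OF y, of n] Suc.prems[of n]
    by (simp add: u_def v_def)
  also have "\<dots> = (v - u) / (u * v)" using uv by (simp add: field_simps)
  finally have "\<bar>(gauss_map ^^ Suc n) x - (gauss_map ^^ Suc n) y\<bar> * (u * v) = \<bar>u - v\<bar>"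
    using uv by (simp add: abs_mult abs_minus_commute)
  then show ?case using Suc by (simp add: u_def v_def mult_ac)
qed simp

lemma J_set_eq: "J_set = {x \<in> irr01. strict_mono (cf_digit x)}"
proof -
  have "(\<forall>n\<ge>1. cf_a n x < cf_a (Suc n) x) \<longleftrightarrow> strict_mono (cf_digit x)" for x
    by (metis One_nat_def Suc_le_D cf_a_Suc le_add1 plus_1_eq_Suc strict_mono_Suc_iff)
  then show ?thesis by (auto simp: J_set_def irr01_def)
qed

lemma J_set_gauss_map_funpow:
  assumes "x \<in> J_set" shows "(gauss_map ^^ n) x \<in> J_set"
  using assms
  by (auto simp: J_set_eq gauss_map_funpow_irr01 cf_digit_gauss_map_funpow strict_mono_def)

lemma J_set_cf_digit_gt:
  assumes "x \<in> J_set" shows "n < cf_digit x n"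
proof (induction n)
  case 0
  show ?case using assms cf_digit_ge_1[of x 0] by (auto simp: J_set_eq)
next
  case (Suc n)
  have "cf_digit x n < cf_digit x (Suc n)" using assms by (auto simp: J_set_eq strict_mono_Suc_iff)
  with Suc show ?case by simp
qed

definition digits_AP :: "real \<Rightarrow> nat \<Rightarrow> nat \<Rightarrow> bool" where
  "digits_AP x m n \<longleftrightarrow> (\<exists>d. \<forall>i<n. cf_digit x (m + i) = cf_digit x m + i * Suc d)"

lemma digits_AP_gauss_map_funpow: "digits_AP ((gauss_map ^^ k) x) m n \<longleftrightarrow> digits_AP x (k + m) n"
  by (simp add: digits_AP_def cf_digit_gauss_map_funpow add.assoc)

lemma cf_block_AP_iff:
  assumes "x \<in> J_set" shows "cf_block_AP x (Suc m) n \<longleftrightarrow> digits_AP x m n"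
proof
  obtain d where second: "cf_digit x (Suc m) = cf_digit x m + Suc d"
    using assms by (auto simp: J_set_eq strict_mono_Suc_iff dest!: spec[of _ m] less_imp_Suc_add)
  assume "cf_block_AP x (Suc m) n"
  then have diff: "int (cf_digit x (Suc (m + i))) - int (cf_digit x (m + i)) = int (Suc d)"
    if "Suc i < n" for i
    using that second by (simp add: cf_block_AP_def cf_a_Suc)
  have "cf_digit x (m + i) = cf_digit x m + i * Suc d" if "i < n" for i
    using that
  proof (induction i)
    case (Suc i)
    then have "int (cf_digit x (m + Suc i)) = int (cf_digit x m + i * Suc d) + int (Suc d)"
      using diff[of i] by simp
    also have "\<dots> = int (cf_digit x m + Suc i * Suc d)" by simp
    finally show ?case by (simp only: of_nat_eq_iff)
  qed simp
  then show "digits_AP x m n" by (auto simp: digits_AP_def)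
next
  assume "digits_AP x m n"
  then obtain d where progression: "\<And>i. i < n \<Longrightarrow> cf_digit x (m + i) = cf_digit x m + i * Suc d"
    by (auto simp: digits_AP_def)
  show "cf_block_AP x (Suc m) n"
    unfolding cf_block_AP_def
  proof (intro allI impI)
    fix i assume "i + 1 < n"
    then show "int (cf_a (Suc m + i + 1) x) - int (cf_a (Suc m + i) x)
        = int (cf_a (Suc m + 1) x) - int (cf_a (Suc m) x)"
      using progression[of "Suc i"] progression[of i] progression[of 1] by (simp add: cf_a_Suc)
  qed
qed

section \<open>Hausdorff content\<close>

text \<open>\<open>H\<^sup>s\<^sub>\<infinity>\<close>, without a restriction on the mesh of the covers.\<close>
definition hcontent :: "real \<Rightarrow> 'a::metric_space set \<Rightarrow> ennreal" where
  "hcontent s E =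
     (INF U \<in> {U :: nat \<Rightarrow> 'a set. E \<subseteq> (\<Union>i. U i) \<and> (\<forall>i. bounded (U i))}.
        (\<Sum>i. ennreal (diameter (U i) powr s)))"

lemma hcontent_le:
  assumes "E \<subseteq> (\<Union>i. U i)" "\<And>i. bounded (U i)"
  shows "hcontent s E \<le> (\<Sum>i::nat. ennreal (diameter (U i) powr s))"
  unfolding hcontent_def using assms by (intro INF_lower) auto

lemma le_cmult_hcontentI:
  assumes k_pos: "k > 0"
    and "\<And>U. E \<subseteq> (\<Union>i. U i) \<Longrightarrow> (\<And>i::nat. bounded (U i)) \<Longrightarrow>
      c \<le> ennreal k * (\<Sum>i. ennreal (diameter (U i) powr s))"
  shows "c \<le> ennreal k * hcontent s E"
proof -
  have "c / ennreal k \<le> hcontent s E"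
    unfolding hcontent_def using assms by (intro INF_greatest divide_le_posI_ennreal) auto
  then have "c / ennreal k * ennreal k \<le> hcontent s E * ennreal k" by (rule mult_right_mono) simp
  also have "c / ennreal k * ennreal k = c"
    using k_pos unfolding ennreal_divide_times by (simp add: ennreal_divide_self)
  finally show ?thesis by (simp add: mult.commute)
qed

lemma hcontent_lessE:
  assumes "hcontent s E < c"
  obtains U where "E \<subseteq> (\<Union>i. U i)" "\<And>i::nat. bounded (U i)"
    "(\<Sum>i. ennreal (diameter (U i) powr s)) < c"
  using assms unfolding hcontent_def INF_less_iff by auto

lemma hcontent_mono: "E \<subseteq> F \<Longrightarrow> hcontent s E \<le> hcontent s F"
  unfolding hcontent_def by (intro INF_superset_mono) auto

lemma hcontent_null_subset: "hcontent s F = 0 \<Longrightarrow> E \<subseteq> F \<Longrightarrow> hcontent s E = 0"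
  using hcontent_mono[of E F s] by simp

lemma hcontent_empty: "hcontent s {} = 0"
  using hcontent_le[of "{}" "\<lambda>_. {}" s] by simp

lemma hcontent_bounded_le:
  assumes "bounded E" shows "hcontent s E \<le> ennreal (diameter E powr s)"
proof -
  let ?U = "\<lambda>i::nat. if i = 0 then E else {}"
  have "hcontent s E \<le> (\<Sum>i. ennreal (diameter (?U i) powr s))"
    using assms by (intro hcontent_le) (auto split: if_splits)
  also have "\<dots> = (\<Sum>i\<in>{0}. ennreal (diameter (?U i) powr s))"
    by (intro suminf_finite) auto
  finally show ?thesis by simp
qed

lemma hcontent_UN_le_double_sum:
  fixes U :: "nat \<Rightarrow> nat \<Rightarrow> 'a::metric_space set"
  assumes cover: "\<And>k. E k \<subseteq> (\<Union>i. U k i)" and bounded: "\<And>k i. bounded (U k i)"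
  shows "hcontent s (\<Union>k. E k) \<le> (\<Sum>k. \<Sum>i. ennreal (diameter (U k i) powr s))"
proof -
  have "(\<Union>k. E k) \<subseteq> \<Union> (range (case_prod U))" using cover by fastforce
  also have "range (case_prod U) = range (\<lambda>j. case_prod U (prod_decode j))"
    by (metis image_image surj_prod_decode)
  finally have "hcontent s (\<Union>k. E k)
      \<le> (\<Sum>j. ennreal (diameter (case_prod U (prod_decode j)) powr s))"
    by (intro hcontent_le) (simp_all add: bounded case_prod_unfold)
  also have "\<dots> = (\<Sum>k. \<Sum>i. ennreal (diameter (U k i) powr s))"
    by (rule suminf_ennreal_2dimen[where f = "\<lambda>p. ennreal (diameter (case_prod U p) powr s)"]) simp
  finally show ?thesis .
qed

lemma hcontent_UN: "hcontent s (\<Union>k. E k) \<le> (\<Sum>k::nat. hcontent s (E k))"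
proof (cases "(\<Sum>k. hcontent s (E k)) = top")
  case False
  then have finite_content: "hcontent s (E k) < top" for k
    by (metis ennreal_suminf_lessD top.not_eq_extremum)
  show ?thesis
  proof (rule ennreal_le_epsilon)
    fix e :: real assume e_pos: "e > 0"
    have "hcontent s (E k) < hcontent s (E k) + ennreal (e * (1/2) ^ Suc k)" for k
      using e_pos finite_content[of k]
      by (cases "hcontent s (E k)") (simp_all flip: ennreal_plus add: ennreal_less_iff)
    then have "\<exists>U. E k \<subseteq> (\<Union>i. U i) \<and> (\<forall>i::nat. bounded (U i)) \<and>
        (\<Sum>i. ennreal (diameter (U i) powr s)) < hcontent s (E k) + ennreal (e * (1/2) ^ Suc k)"
      for k
      by (metis hcontent_lessE)
    then obtain U where cover: "\<And>k. E k \<subseteq> (\<Union>i. U k i)" "\<And>k i::nat. bounded (U k i)"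
      and weight: "\<And>k. (\<Sum>i. ennreal (diameter (U k i) powr s))
        < hcontent s (E k) + ennreal (e * (1/2) ^ Suc k)"
      by metis
    have "hcontent s (\<Union>k. E k) \<le> (\<Sum>k. \<Sum>i. ennreal (diameter (U k i) powr s))"
      using cover by (rule hcontent_UN_le_double_sum)
    also have "\<dots> \<le> (\<Sum>k. hcontent s (E k) + ennreal (e * (1/2) ^ Suc k))"
      by (intro suminf_le less_imp_le weight) auto
    also have "\<dots> = (\<Sum>k. hcontent s (E k)) + (\<Sum>k. ennreal (e * (1/2) ^ Suc k))"
      by (intro suminf_add[symmetric]) auto
    also have "(\<Sum>k. ennreal (e * (1/2) ^ Suc k)) = ennreal e"
      using e_pos sums_mult[OF power_half_series, of e] by (intro suminf_ennreal_eq) auto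
    finally show "hcontent s (\<Union>k. E k) \<le> (\<Sum>k. hcontent s (E k)) + ennreal e" .
  qed
qed simp

lemma hcontent_UN_null:
  assumes "\<And>k::nat. hcontent s (E k) = 0" shows "hcontent s (\<Union>k. E k) = 0"
  using hcontent_UN[of s E] assms by simp

lemma hcontent_inverse_holder:
  fixes g :: "'a::metric_space \<Rightarrow> 'b::metric_space"
  assumes t_pos: "t > 0" and \<alpha>_pos: "\<alpha> > 0" and C_nonneg: "C \<ge> 0" and image: "g ` F \<subseteq> E"
    and holder: "\<And>x y. x \<in> F \<Longrightarrow> y \<in> F \<Longrightarrow> dist x y \<le> C * dist (g x) (g y) powr \<alpha>"
  shows "hcontent t F \<le> ennreal (C powr t) * hcontent (\<alpha> * t) E"
proof (cases "C = 0")
  case True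
  then have "x = y" if "x \<in> F" "y \<in> F" for x y using holder[OF that] by simp
  then have "F = {} \<or> (\<exists>x. F = {x})" by blast
  then have "hcontent t F = 0" using hcontent_bounded_le[of F t] t_pos by auto
  then show ?thesis by simp
next
  case False
  with C_nonneg have C_pos: "C > 0" by simp
  show ?thesis
  proof (rule le_cmult_hcontentI)
    fix U :: "nat \<Rightarrow> 'b set" assume U: "E \<subseteq> (\<Union>i. U i)" and bounded_U: "\<And>i. bounded (U i)"
    define V where "V i = {x \<in> F. g x \<in> U i}" for i
    have dist: "dist x y \<le> C * diameter (U i) powr \<alpha>" if "x \<in> V i" "y \<in> V i" for x y i
    proof -
      have "dist (g x) (g y) powr \<alpha> \<le> diameter (U i) powr \<alpha>"
        using that \<alpha>_pos by (intro powr_mono2 diameter_bounded_bound bounded_U) (auto simp: V_def)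
      then have "C * dist (g x) (g y) powr \<alpha> \<le> C * diameter (U i) powr \<alpha>" using C_pos by simp
      then show ?thesis using holder[of x y] that by (auto simp: V_def)
    qed
    have bounded_V: "bounded (V i)" for i using dist unfolding bounded_def by blast
    have "diameter (V i) \<le> C * diameter (U i) powr \<alpha>" for i
      using dist C_pos unfolding diameter_def[of "V i"] by (auto intro!: cSUP_least)
    then have "diameter (V i) powr t \<le> (C * diameter (U i) powr \<alpha>) powr t" for i
      using t_pos diameter_ge_0[OF bounded_V] by (intro powr_mono2) auto
    then have diam: "diameter (V i) powr t \<le> C powr t * diameter (U i) powr (\<alpha> * t)" for i
      by (simp add: powr_mult powr_powr)
    have "F \<subseteq> (\<Union>i. V i)" unfolding V_def using U image by blast
    then have "hcontent t F \<le> (\<Sum>i. ennreal (diameter (V i) powr t))"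
      using bounded_V by (rule hcontent_le)
    also have "\<dots> \<le> (\<Sum>i. ennreal (C powr t) * ennreal (diameter (U i) powr (\<alpha> * t)))"
      using diam by (intro suminf_le) (auto intro!: ennreal_leI simp flip: ennreal_mult)
    also have "\<dots> = ennreal (C powr t) * (\<Sum>i. ennreal (diameter (U i) powr (\<alpha> * t)))" by simp
    finally show "hcontent t F \<le> ennreal (C powr t) * (\<Sum>i. ennreal (diameter (U i) powr (\<alpha> * t)))" .
  qed (use C_pos in simp)
qed

lemma emeasure_lborel_le_hcontent:
  fixes F :: "real set" shows "emeasure lborel F \<le> ennreal 2 * hcontent 1 F"
proof (rule le_cmult_hcontentI)
  fix U :: "nat \<Rightarrow> real set" assume U: "F \<subseteq> (\<Union>i. U i)" and bounded_U: "\<And>i. bounded (U i)"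
  define c where "c i = (SOME z. z \<in> U i)" for i
  define I where "I i = {c i - diameter (U i)..c i + diameter (U i)}" for i
  have "U i \<subseteq> I i" for i
  proof
    fix z assume z: "z \<in> U i"
    then have "c i \<in> U i" unfolding c_def by (rule someI)
    then have "dist z (c i) \<le> diameter (U i)" using z by (intro diameter_bounded_bound bounded_U)
    then show "z \<in> I i" by (auto simp: I_def dist_real_def)
  qed
  with U have "F \<subseteq> (\<Union>i. I i)" by blast
  then have "emeasure lborel F \<le> emeasure lborel (\<Union>i. I i)"
    by (intro emeasure_mono) (auto simp: I_def)
  also have "\<dots> \<le> (\<Sum>i. emeasure lborel (I i))"
    by (intro emeasure_subadditive_countably) (auto simp: I_def)
  also have "\<dots> = (\<Sum>i. ennreal 2 * ennreal (diameter (U i) powr 1))"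
    using diameter_ge_0[OF bounded_U] by (intro suminf_cong) (simp add: I_def ennreal_mult)
  also have "\<dots> = ennreal 2 * (\<Sum>i. ennreal (diameter (U i) powr 1))" by simp
  finally show "emeasure lborel F \<le> ennreal 2 * (\<Sum>i. ennreal (diameter (U i) powr 1))" .
qed simp

lemma diam_pow_eq_powr: "s > 0 \<Longrightarrow> diam_pow s U = diameter U powr s"
  by (auto simp: diam_pow_def)

lemma hcontent_le_hausdorff_measure:
  assumes "s > 0" shows "hcontent s E \<le> hausdorff_measure s E"
proof -
  have "hcontent s E \<le> hausdorff_content 1 s E"
    unfolding hausdorff_content_def
    using hcontent_le[of E] by (intro INF_greatest) (auto simp: diam_pow_eq_powr assms)
  also have "\<dots> \<le> hausdorff_measure s E" unfolding hausdorff_measure_def by (intro SUP_upper) simp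
  finally show ?thesis .
qed

text \<open>A cover of small total weight has small diameters, so the mesh restriction in the Hausdorff
  measure is void for null sets.\<close>
lemma hausdorff_content_null:
  assumes s_pos: "s > 0" and null: "hcontent s E = 0" and \<delta>_pos: "\<delta> > 0"
  shows "hausdorff_content \<delta> s E = 0"
proof -
  have "hausdorff_content \<delta> s E \<le> 0 + ennreal e" if e_pos: "e > 0" for e
  proof -
    have "hcontent s E < ennreal (min e (\<delta> powr s))" using null \<delta>_pos e_pos by simp
    then obtain U where U: "E \<subseteq> (\<Union>i. U i)" "\<And>i::nat. bounded (U i)"
        "(\<Sum>i. ennreal (diameter (U i) powr s)) < ennreal (min e (\<delta> powr s))"
      by (rule hcontent_lessE) blast
    have "diameter (U i) powr s < \<delta> powr s" for i
      using ennreal_suminf_lessD[OF U(3), of i] \<delta>_pos e_pos by (simp add: ennreal_less_iff)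
    then have "diameter (U i) \<le> \<delta>" for i
      using powr_mono2[of s \<delta> "diameter (U i)"] s_pos \<delta>_pos by (meson less_imp_le linorder_not_less)
    then have "hausdorff_content \<delta> s E \<le> (\<Sum>i. ennreal (diam_pow s (U i)))"
      unfolding hausdorff_content_def using U by (intro INF_lower) auto
    also have "\<dots> \<le> ennreal (min e (\<delta> powr s))"
      using U(3) by (simp add: diam_pow_eq_powr s_pos less_imp_le)
    also have "\<dots> \<le> ennreal e" by (intro ennreal_leI) simp
    finally show ?thesis by simp
  qed
  then have "hausdorff_content \<delta> s E \<le> 0" by (rule ennreal_le_epsilon)
  then show ?thesis by simp
qed

lemma hausdorff_measure_eq_0_iff:
  assumes s_pos: "s > 0" shows "hausdorff_measure s E = 0 \<longleftrightarrow> hcontent s E = 0"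
proof
  assume "hcontent s E = 0"
  then show "hausdorff_measure s E = 0"
    unfolding hausdorff_measure_def using hausdorff_content_null[OF s_pos]
    by (intro antisym SUP_least) auto
qed (use hcontent_le_hausdorff_measure[OF s_pos, of E] in simp)

lemma hausdorff_measure_0_eq_0_imp_empty:
  assumes "hausdorff_measure 0 E = 0" shows "E = {}"
proof -
  have "hausdorff_content 1 0 E \<le> hausdorff_measure 0 E"
    unfolding hausdorff_measure_def by (intro SUP_upper) simp
  then have "hausdorff_content 1 0 E < 1" using assms by simp
  then obtain U where U: "E \<subseteq> (\<Union>i::nat. U i)" "(\<Sum>i. ennreal (diam_pow 0 (U i))) < 1"
    unfolding hausdorff_content_def INF_less_iff by auto
  have "U i = {}" for i
  proof (rule ccontr)
    assume "U i \<noteq> {}"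
    then have "diam_pow 0 (U i) = 1" by (simp add: diam_pow_def)
    then show False using ennreal_suminf_lessD[OF U(2), of i] by simp
  qed
  then show ?thesis using U(1) by simp
qed

lemma hausdorff_dim_eqI:
  assumes d_nonneg: "d \<ge> 0"
    and null: "\<And>s. s > d \<Longrightarrow> hcontent s E = 0"
    and nonnull: "\<And>s. 0 < s \<Longrightarrow> s < d \<Longrightarrow> hcontent s E \<noteq> 0"
  shows "hausdorff_dim E = d"
proof -
  define X where "X = {s. s \<ge> 0 \<and> hausdorff_measure s E = 0}"
  have above: "s \<in> X" if "s > d" for s
    using null[OF that] that d_nonneg by (simp add: X_def hausdorff_measure_eq_0_iff)
  have below: "d \<le> x" if x: "x \<in> X" for x
  proof (rule ccontr)
    assume "\<not> d \<le> x"
    then have "x < d" by simp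
    show False
    proof (cases "x = 0")
      case True
      then have "E = {}" using x hausdorff_measure_0_eq_0_imp_empty by (simp add: X_def)
      then show False using nonnull[of "d / 2"] \<open>x < d\<close> True by (simp add: hcontent_empty)
    next
      case False
      then show False
        using x nonnull[of x] \<open>x < d\<close> hausdorff_measure_eq_0_iff[of x E] by (simp add: X_def)
    qed
  qed
  have "bdd_below X" using below by (rule bdd_belowI)
  then have "Inf X \<le> d" by (intro cInf_lower above dense_ge[of d "Inf X"])
  moreover have "d \<le> Inf X" using above[of "d + 1"] by (intro cInf_greatest below) auto
  ultimately show ?thesis by (simp add: hausdorff_dim_def X_def)
qed

section \<open>Content of cylinder sets\<close>

definition cf_cylinder :: "(nat \<Rightarrow> nat) \<Rightarrow> nat \<Rightarrow> real set \<Rightarrow> real set" where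
  "cf_cylinder a n E = {x \<in> irr01. (\<forall>i<n. cf_digit x i = a i) \<and> (gauss_map ^^ n) x \<in> E}"

lemma cf_cylinder_dist_le:
  assumes x: "x \<in> cf_cylinder a n E" and y: "y \<in> cf_cylinder a n E"
  shows "\<bar>x - y\<bar> \<le> (\<Prod>i<n. real (a i) powr - 2) * \<bar>(gauss_map ^^ n) x - (gauss_map ^^ n) y\<bar>"
proof -
  have irrational: "x \<in> irr01" "y \<in> irr01" using x y by (auto simp: cf_cylinder_def)
  have digits: "cf_digit x i = a i" "cf_digit y i = a i" if "i < n" for i
    using x y that by (auto simp: cf_cylinder_def)
  have "(\<Prod>i<n. (gauss_map ^^ i) x * (gauss_map ^^ i) y) \<le> (\<Prod>i<n. real (a i) powr - 2)"
  proof (intro prod_mono conjI)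
    fix i assume "i \<in> {..<n}"
    then have "i < n" by simp
    note pos = irrational[THEN gauss_map_funpow_irr01, THEN irr01_bounds(1), of i, THEN less_imp_le]
    show "0 \<le> (gauss_map ^^ i) x * (gauss_map ^^ i) y" using pos by simp
    have "(gauss_map ^^ i) x * (gauss_map ^^ i) y \<le> (1 / real (a i)) * (1 / real (a i))"
      using irrational[THEN gauss_map_funpow_le, of i] digits[OF \<open>i < n\<close>] pos
      by (intro mult_mono) auto
    also have "\<dots> = real (a i) powr - 2"
      using cf_digit_ge_1[OF irrational(1), of i] digits[OF \<open>i < n\<close>]
      by (simp add: powr_minus_divide power2_eq_square)
    finally show "(gauss_map ^^ i) x * (gauss_map ^^ i) y \<le> real (a i) powr - 2" .
  qed
  then show ?thesis
    using gauss_map_funpow_dist[OF irrational, of n] digits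
    by (simp add: mult.commute mult_left_mono)
qed

lemma hcontent_cf_cylinder_le:
  assumes "s > 0"
  shows "hcontent s (cf_cylinder a n E) \<le> ennreal (\<Prod>i<n. real (a i) powr (- 2 * s)) * hcontent s E"
proof -
  have "hcontent s (cf_cylinder a n E)
      \<le> ennreal ((\<Prod>i<n. real (a i) powr - 2) powr s) * hcontent (1 * s) E"
    using assms cf_cylinder_dist_le[of _ a n E]
    by (intro hcontent_inverse_holder[where g = "gauss_map ^^ n"])
       (auto simp: dist_real_def prod_nonneg cf_cylinder_def)
  then show ?thesis by (simp add: prod_powr_distrib powr_powr)
qed

lemma hcontent_gauss_map_preimage_null:
  assumes s_pos: "s > 0" and "hcontent s E = 0"
  shows "hcontent s {x \<in> irr01. (gauss_map ^^ n) x \<in> E} = 0"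
  using assms(2)
proof (induction n arbitrary: E)
  case 0
  then show ?case by (rule hcontent_null_subset) auto
next
  case (Suc n)
  have "hcontent s (cf_cylinder (\<lambda>_. k) 1 E) = 0" for k
    using hcontent_cf_cylinder_le[OF s_pos, of "\<lambda>_. k" 1 E] Suc.prems by simp
  then have "hcontent s (\<Union>k. cf_cylinder (\<lambda>_. k) 1 E) = 0" by (rule hcontent_UN_null)
  then have "hcontent s {x \<in> irr01. gauss_map x \<in> E} = 0"
    by (rule hcontent_null_subset) (auto simp: cf_cylinder_def)
  from Suc.IH[OF this] show ?case
    by (rule hcontent_null_subset) (auto simp: gauss_map_funpow_irr01)
qed

section \<open>Weights of free digits and of progressions\<close>

definition zeta_tail :: "real \<Rightarrow> nat \<Rightarrow> ennreal" where
  "zeta_tail \<tau> P = (\<Sum>k. ennreal (real (P + 1 + k) powr - \<tau>))"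

lemma zeta_tail_antimono:
  assumes "\<tau> \<ge> 0" "P \<le> b" shows "zeta_tail \<tau> b \<le> zeta_tail \<tau> P"
  unfolding zeta_tail_def using assms by (intro suminf_le ennreal_leI powr_mono2') auto

lemma zeta_tail_eq_ennreal:
  assumes "\<tau> > 1" shows "zeta_tail \<tau> P = ennreal (\<Sum>k. real (k + Suc P) powr - \<tau>)"
proof -
  have "summable (\<lambda>k. real k powr - \<tau>)" using assms by (simp add: summable_real_powr_iff)
  then have "summable (\<lambda>k. real (k + Suc P) powr - \<tau>)" by (rule summable_ignore_initial_segment)
  then show ?thesis
    unfolding zeta_tail_def by (subst suminf_ennreal2[symmetric]) (auto simp: ac_simps)
qed

lemma zeta_tail_tendsto_0:
  assumes "\<tau> > 1" shows "zeta_tail \<tau> \<longlonglongrightarrow> 0"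
proof -
  have "summable (\<lambda>k. real k powr - \<tau>)" using assms by (simp add: summable_real_powr_iff)
  then have "(\<lambda>P. \<Sum>k. real (k + Suc P) powr - \<tau>) \<longlonglongrightarrow> 0"
    using LIMSEQ_Suc[OF suminf_exist_split2] by blast
  then have "(\<lambda>P. ennreal (\<Sum>k. real (k + Suc P) powr - \<tau>)) \<longlonglongrightarrow> ennreal 0" by (rule tendsto_ennrealI)
  then show ?thesis by (simp only: zeta_tail_eq_ennreal[OF assms, symmetric] ennreal_0)
qed

lemma zeta_tail_threshold:
  assumes "\<tau> > 1"
  obtains P where "P \<ge> 1" "zeta_tail \<tau> P \<le> 1" "zeta_tail 2 P * zeta_tail 2 0 \<le> ennreal (1 / 2)"
proof -
  have "(\<lambda>P. zeta_tail 2 0 * zeta_tail 2 P) \<longlonglongrightarrow> zeta_tail 2 0 * 0"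
    by (intro ennreal_tendsto_cmult zeta_tail_tendsto_0) (auto simp: zeta_tail_eq_ennreal)
  then have "\<forall>\<^sub>F P in sequentially. zeta_tail 2 0 * zeta_tail 2 P < ennreal (1 / 2)"
    by (rule order_tendstoD) (use ennreal_less_zero_iff[of "1 / 2"] in auto)
  moreover have "\<forall>\<^sub>F P in sequentially. zeta_tail \<tau> P < 1"
    using zeta_tail_tendsto_0[OF assms] by (rule order_tendstoD) simp
  ultimately have "\<forall>\<^sub>F P in sequentially.
      P \<ge> 1 \<and> zeta_tail \<tau> P \<le> 1 \<and> zeta_tail 2 P * zeta_tail 2 0 \<le> ennreal (1 / 2)"
    using eventually_ge_at_top[of 1] by eventually_elim (auto simp: mult.commute)
  then show ?thesis using that by (auto simp: eventually_sequentially)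
qed

definition AP_weight :: "real \<Rightarrow> nat \<Rightarrow> nat \<Rightarrow> nat \<Rightarrow> real" where
  "AP_weight s n a d = (\<Prod>i<n. real (a + i * Suc d) powr (- 2 * s))"

text \<open>\<open>r\<close> of the factors pay for summability over the two parameters of a progression; the
  remaining ones are bounded by powers of the first term.\<close>
lemma AP_weight_le:
  assumes s_pos: "s > 0" and a: "1 \<le> a" and q: "1 \<le> q" and r_large: "s * real r \<ge> 2"
  shows "AP_weight s (q + r) a d
    \<le> real a powr (- (2 * s * real q)) * (real a powr - 2 * real (Suc d) powr - 2)"
proof -
  let ?f = "\<lambda>i. real (a + i * Suc d) powr (- 2 * s)"
  have "1 \<le> a * Suc d" using a by simp
  then have "1 \<le> real (a * Suc d)" by (simp only: real_of_nat_ge_one_iff)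
  have head: "?f i \<le> real a powr (- 2 * s)" for i
    using s_pos a by (intro powr_mono2') auto
  have tail: "?f i \<le> real (a * Suc d) powr (- s)" if "i \<ge> q" for i
  proof -
    have "1 * Suc d \<le> i * Suc d" using that q by (intro mult_le_mono1) linarith
    then have "a * Suc d \<le> (a + i * Suc d) * (a + i * Suc d)" by (intro mult_le_mono) auto
    then have "real (a * Suc d) \<le> real (a + i * Suc d) * real (a + i * Suc d)"
      by (simp only: of_nat_mult[symmetric] of_nat_le_iff)
    then have "(real (a + i * Suc d) * real (a + i * Suc d)) powr (- s)
        \<le> real (a * Suc d) powr (- s)"
      using s_pos \<open>1 \<le> real (a * Suc d)\<close> by (intro powr_mono2') auto
    then show ?thesis by (simp add: powr_mult flip: powr_add)
  qed
  have "AP_weight s (q + r) a d = (\<Prod>i\<in>{0..<q}. ?f i) * (\<Prod>i\<in>{q..<q + r}. ?f i)"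
    by (simp add: AP_weight_def lessThan_atLeast0 prod.atLeastLessThan_concat)
  also have "\<dots> \<le> (\<Prod>i\<in>{0..<q}. real a powr (- 2 * s))
      * (\<Prod>i\<in>{q..<q + r}. real (a * Suc d) powr (- s))"
    using head tail by (intro mult_mono prod_mono) (auto intro!: prod_nonneg)
  also have "(\<Prod>i\<in>{0..<q}. real a powr (- 2 * s)) = real a powr (- (2 * s * real q))"
    using a by (simp add: powr_powr flip: powr_realpow)
  also have "(\<Prod>i\<in>{q..<q + r}. real (a * Suc d) powr (- s)) = real (a * Suc d) powr (- (s * real r))"
    using a by (simp add: powr_powr flip: powr_realpow del: of_nat_mult of_nat_Suc)
  also have "real (a * Suc d) powr (- (s * real r)) \<le> real (a * Suc d) powr - 2"
    using r_large \<open>1 \<le> real (a * Suc d)\<close> by (intro powr_mono) auto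
  also have "real (a * Suc d) powr - 2 = real a powr - 2 * real (Suc d) powr - 2"
    by (simp only: of_nat_mult powr_mult)
  finally show ?thesis by (simp add: mult_left_mono)
qed

section \<open>The upper bound\<close>

text \<open>In \<open>\<sigma> n\<close> positions of digits are counted from \<open>1\<close>, in \<^const>\<open>cf_digit\<close> from \<open>0\<close>.\<close>
locale block_positions =
  fixes \<sigma> :: "nat \<Rightarrow> nat"
  assumes pos: "1 \<le> n \<Longrightarrow> 0 < \<sigma> n"
    and gap_ge: "1 \<le> n \<Longrightarrow> \<sigma> n + n \<le> \<sigma> (Suc n)"
begin

definition gap :: "nat \<Rightarrow> nat" where
  "gap n = \<sigma> (Suc n) - \<sigma> n"

lemma le_gap: "1 \<le> n \<Longrightarrow> n \<le> gap n"
  using gap_ge[of n] by (simp add: gap_def)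

lemma sigma_Suc: "1 \<le> n \<Longrightarrow> \<sigma> (Suc n) = \<sigma> n + gap n"
  using gap_ge[of n] by (simp add: gap_def)

lemma G_set_eq: "G_set \<sigma> = {x \<in> J_set. \<exists>N. \<forall>n\<ge>N. digits_AP x (\<sigma> n - 1) n}"
proof -
  have block: "cf_block_AP x (\<sigma> n) n \<longleftrightarrow> digits_AP x (\<sigma> n - 1) n" if "x \<in> J_set" "n \<ge> 1" for x n
    using cf_block_AP_iff[OF that(1), of "\<sigma> n - 1" n] pos[OF that(2)] by simp
  have "(\<exists>N. \<forall>n\<ge>N. cf_block_AP x (\<sigma> n) n) \<longleftrightarrow> (\<exists>N. \<forall>n\<ge>N. digits_AP x (\<sigma> n - 1) n)"
    if "x \<in> J_set" for x
    unfolding eventually_sequentially[symmetric]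
    by (intro eventually_subst eventually_mono[OF eventually_ge_at_top[of 1]] block[OF that])
  then show ?thesis by (auto simp: G_set_def)
qed

text \<open>The possible values of the \<open>m\<close>-th Gauss iterate of a point of \<open>G_set \<sigma>\<close> whose
  progressions start at index \<open>N\<close> and whose next digit exceeds \<open>b\<close>.\<close>
definition tail_set :: "nat \<Rightarrow> nat \<Rightarrow> nat \<Rightarrow> real set" where
  "tail_set N m b = {t \<in> J_set. b < cf_digit t 0 \<and>
     (\<forall>n\<ge>N. m < \<sigma> n \<longrightarrow> digits_AP t (\<sigma> n - Suc m) n)}"

lemma tail_set_antimono: "b \<le> c \<Longrightarrow> tail_set N m c \<subseteq> tail_set N m b"
  by (auto simp: tail_set_def)

lemma tail_set_subset_irr01: "tail_set N m b \<subseteq> irr01"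
  by (auto simp: tail_set_def J_set_eq)

lemma hcontent_tail_set_le_1:
  assumes "s > 0" shows "hcontent s (tail_set N m b) \<le> 1"
proof -
  have "irr01 \<subseteq> {0..1}" by (auto simp: irr01_def)
  with tail_set_subset_irr01 have "tail_set N m b \<subseteq> {0..1}" by (rule subset_trans)
  then have "hcontent s (tail_set N m b) \<le> hcontent s {0..1::real}" by (rule hcontent_mono)
  also have "\<dots> \<le> ennreal (diameter {0..1::real} powr s)" by (intro hcontent_bounded_le) simp
  finally show ?thesis by simp
qed

lemma tail_set_funpow:
  assumes "t \<in> tail_set N m b" and "b' < cf_digit t n"
  shows "(gauss_map ^^ n) t \<in> tail_set N (m + n) b'"
  using assms
  by (auto simp: tail_set_def J_set_gauss_map_funpow digits_AP_gauss_map_funpow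
    cf_digit_gauss_map_funpow)

lemma hcontent_tail_set_free_digit_le:
  assumes s_pos: "s > 0"
  shows "hcontent s (tail_set N m b) \<le>
    (\<Sum>k. ennreal (real (b + 1 + k) powr (- 2 * s)) * hcontent s (tail_set N (Suc m) (b + 1 + k)))"
proof -
  let ?F = "\<lambda>k. cf_cylinder (\<lambda>_. b + 1 + k) 1 (tail_set N (Suc m) (b + 1 + k))"
  have "tail_set N m b \<subseteq> (\<Union>k. ?F k)"
  proof
    fix t assume t_in: "t \<in> tail_set N m b"
    then have in_J: "t \<in> J_set" and "b < cf_digit t 0" by (auto simp: tail_set_def)
    then obtain k where first_digit: "cf_digit t 0 = b + 1 + k" by (auto dest: less_imp_Suc_add)
    have "cf_digit t 0 < cf_digit t 1" using in_J by (auto simp: J_set_eq strict_mono_def)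
    then have "t \<in> ?F k"
      using tail_set_funpow[OF t_in, of _ 1] first_digit in_J
      by (auto simp: cf_cylinder_def J_set_eq)
    then show "t \<in> (\<Union>k. ?F k)" by blast
  qed
  then have "hcontent s (tail_set N m b) \<le> hcontent s (\<Union>k. ?F k)" by (rule hcontent_mono)
  also have "\<dots> \<le> (\<Sum>k. hcontent s (?F k))" by (rule hcontent_UN)
  also have "\<dots> \<le> (\<Sum>k. ennreal (real (b + 1 + k) powr (- 2 * s))
      * hcontent s (tail_set N (Suc m) (b + 1 + k)))"
  proof (intro suminf_le)
    fix k
    show "hcontent s (?F k)
        \<le> ennreal (real (b + 1 + k) powr (- 2 * s)) * hcontent s (tail_set N (Suc m) (b + 1 + k))"
      using hcontent_cf_cylinder_le[OF s_pos, of "\<lambda>_. b + 1 + k" 1] by simp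
  qed auto
  finally show ?thesis .
qed

lemma hcontent_tail_set_AP_le:
  assumes s_pos: "s > 0" and n: "N \<le> n" "\<sigma> n = Suc m"
  shows "hcontent s (tail_set N m b) \<le>
    (\<Sum>k. \<Sum>d. ennreal (AP_weight s n (b + 1 + k) d) * hcontent s (tail_set N (m + n) b))"
proof -
  let ?F = "\<lambda>k d. cf_cylinder (\<lambda>i. b + 1 + k + i * Suc d) n (tail_set N (m + n) b)"
  have "tail_set N m b \<subseteq> (\<Union>k. \<Union>d. ?F k d)"
  proof
    fix t assume t_in: "t \<in> tail_set N m b"
    then have in_J: "t \<in> J_set" and b_less: "b < cf_digit t 0" by (auto simp: tail_set_def)
    from b_less obtain k where first_digit: "cf_digit t 0 = b + 1 + k"
      by (auto dest: less_imp_Suc_add)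
    have "digits_AP t 0 n" using t_in n by (auto simp: tail_set_def)
    then obtain d where progression: "\<forall>i<n. cf_digit t i = cf_digit t 0 + i * Suc d"
      unfolding digits_AP_def by auto
    have "cf_digit t 0 \<le> cf_digit t n"
      using in_J by (auto simp: J_set_eq dest: strict_mono_mono monoD[of _ 0 n])
    with b_less have "(gauss_map ^^ n) t \<in> tail_set N (m + n) b"
      by (intro tail_set_funpow[OF t_in]) simp
    then have "t \<in> ?F k d" using progression first_digit in_J
      by (auto simp: cf_cylinder_def J_set_eq)
    then show "t \<in> (\<Union>k. \<Union>d. ?F k d)" by blast
  qed
  then have "hcontent s (tail_set N m b) \<le> hcontent s (\<Union>k. \<Union>d. ?F k d)" by (rule hcontent_mono)
  also have "\<dots> \<le> (\<Sum>k. hcontent s (\<Union>d. ?F k d))" by (rule hcontent_UN)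
  also have "\<dots> \<le> (\<Sum>k. \<Sum>d. hcontent s (?F k d))" by (intro suminf_le hcontent_UN) auto
  also have "\<dots> \<le>
      (\<Sum>k. \<Sum>d. ennreal (AP_weight s n (b + 1 + k) d) * hcontent s (tail_set N (m + n) b))"
    unfolding AP_weight_def by (intro suminf_le hcontent_cf_cylinder_le s_pos) auto
  finally show ?thesis .
qed

lemma hcontent_tail_set_free_digit_powr_le:
  assumes s_pos: "s > 0" and \<tau>_nonneg: "\<tau> \<ge> 0"
    and P_large: "P \<ge> 1" "zeta_tail \<tau> P \<le> 1" and K_nonneg: "K \<ge> 0" and \<mu>_nonneg: "\<mu> \<ge> 0"
    and bound: "\<And>c. c \<ge> P \<Longrightarrow>
      hcontent s (tail_set N (Suc m) c) \<le> ennreal (K * real c powr (2 * s - \<tau> - \<mu>))"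
    and b_ge: "b \<ge> P"
  shows "hcontent s (tail_set N m b) \<le> ennreal (K * real b powr - \<mu>)"
proof -
  have summand: "ennreal (real c powr (- 2 * s)) * hcontent s (tail_set N (Suc m) c)
      \<le> ennreal (K * real b powr - \<mu>) * ennreal (real c powr - \<tau>)" if "c \<ge> b" for c
  proof -
    have "ennreal (real c powr (- 2 * s)) * hcontent s (tail_set N (Suc m) c)
      \<le> ennreal (real c powr (- 2 * s)) * ennreal (K * real c powr (2 * s - \<tau> - \<mu>))"
      using that b_ge by (intro mult_left_mono bound) auto
    also have "\<dots> = ennreal (K * (real c powr (- 2 * s) * real c powr (2 * s - \<tau> - \<mu>)))"
      using K_nonneg by (simp flip: ennreal_mult add: mult_ac)
    also have "real c powr (- 2 * s) * real c powr (2 * s - \<tau> - \<mu>)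
        = real c powr - \<mu> * real c powr - \<tau>"
      by (simp flip: powr_add add: algebra_simps)
    also have "ennreal (K * (real c powr - \<mu> * real c powr - \<tau>))
        \<le> ennreal (K * (real b powr - \<mu> * real c powr - \<tau>))"
      using K_nonneg \<mu>_nonneg that b_ge P_large
      by (intro ennreal_leI mult_left_mono mult_right_mono powr_mono2') auto
    also have "\<dots> = ennreal (K * real b powr - \<mu>) * ennreal (real c powr - \<tau>)"
      using K_nonneg by (simp flip: ennreal_mult add: mult_ac)
    finally show ?thesis .
  qed
  have "hcontent s (tail_set N m b) \<le>
    (\<Sum>k. ennreal (real (b + 1 + k) powr (- 2 * s)) * hcontent s (tail_set N (Suc m) (b + 1 + k)))"
    by (rule hcontent_tail_set_free_digit_le[OF s_pos])
  also have "\<dots> \<le> (\<Sum>k. ennreal (K * real b powr - \<mu>) * ennreal (real (b + 1 + k) powr - \<tau>))"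
    by (intro suminf_le summand) auto
  also have "\<dots> = ennreal (K * real b powr - \<mu>) * zeta_tail \<tau> b" by (simp add: zeta_tail_def)
  also have "\<dots> \<le> ennreal (K * real b powr - \<mu>) * 1"
    using zeta_tail_antimono[OF \<tau>_nonneg b_ge] P_large by (intro mult_left_mono) auto
  finally show ?thesis by simp
qed

lemma hcontent_tail_set_free_digits_powr_le:
  assumes s_pos: "s > 0" and \<tau>_nonneg: "\<tau> \<ge> 0"
    and P_large: "P \<ge> 1" "zeta_tail \<tau> P \<le> 1" and K_nonneg: "K \<ge> 0"
    and \<kappa>_bounds: "\<kappa> \<ge> 0" "\<kappa> + real g * (2 * s - \<tau>) \<ge> 0"
    and bound: "\<And>b. b \<ge> P \<Longrightarrow> hcontent s (tail_set N (m + g) b) \<le> ennreal (K * real b powr - \<kappa>)"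
    and b_ge: "b \<ge> P"
  shows "hcontent s (tail_set N m b) \<le> ennreal (K * real b powr - (\<kappa> + real g * (2 * s - \<tau>)))"
  using \<kappa>_bounds(2) bound b_ge
proof (induction g arbitrary: m b)
  case 0
  then show ?case by simp
next
  case (Suc g)
  show ?case
  proof (rule hcontent_tail_set_free_digit_powr_le[OF s_pos \<tau>_nonneg P_large K_nonneg])
    fix c assume c: "c \<ge> P"
    have "\<kappa> + real g * (2 * s - \<tau>) \<ge> 0"
    proof (cases "2 * s \<ge> \<tau>")
      case False
      then show ?thesis using Suc.prems(1) by (simp add: algebra_simps)
    qed (use \<kappa>_bounds(1) in simp)
    then have "hcontent s (tail_set N (Suc m) c)
        \<le> ennreal (K * real c powr - (\<kappa> + real g * (2 * s - \<tau>)))"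
      using Suc.prems(2) c by (intro Suc.IH) auto
    then show "hcontent s (tail_set N (Suc m) c)
        \<le> ennreal (K * real c powr (2 * s - \<tau> - (\<kappa> + real (Suc g) * (2 * s - \<tau>))))"
      by (simp add: algebra_simps)
  qed (use Suc.prems in auto)
qed

lemma hcontent_tail_set_AP_powr_le:
  assumes s_pos: "s > 0" and r_large: "s * real r \<ge> 2" and n: "N \<le> n" "r < n" "\<sigma> n = Suc m"
    and P_large: "P \<ge> 1" "zeta_tail 2 P * zeta_tail 2 0 \<le> ennreal (1 / 2)" and K_nonneg: "K \<ge> 0"
    and bound: "hcontent s (tail_set N (m + n) P) \<le> ennreal K" and b_ge: "b \<ge> P"
  shows "hcontent s (tail_set N m b) \<le> ennreal (K / 2 * real b powr - (2 * s * real (n - r)))"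
proof -
  define w where "w = real b powr - (2 * s * real (n - r))"
  have summand: "ennreal (AP_weight s n a d) * hcontent s (tail_set N (m + n) b)
      \<le> ennreal (K * w) * ennreal (real a powr - 2) * ennreal (real (0 + 1 + d) powr - 2)"
    if "b \<le> a" for a d
  proof -
    have "AP_weight s n a d = AP_weight s (n - r + r) a d" using n by simp
    also have "\<dots> \<le> real a powr - (2 * s * real (n - r)) * (real a powr - 2 * real (Suc d) powr - 2)"
      using n b_ge P_large(1) that by (intro AP_weight_le s_pos r_large) auto
    also have "\<dots> \<le> w * (real a powr - 2 * real (Suc d) powr - 2)"
      unfolding w_def using s_pos b_ge P_large that by (auto intro!: mult_right_mono powr_mono2')
    finally have weight: "AP_weight s n a d \<le> w * (real a powr - 2 * real (Suc d) powr - 2)" .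
    have "hcontent s (tail_set N (m + n) b) \<le> ennreal K"
      using hcontent_mono[OF tail_set_antimono[OF b_ge]] bound order_trans by blast
    then have "ennreal (AP_weight s n a d) * hcontent s (tail_set N (m + n) b)
        \<le> ennreal (w * (real a powr - 2 * real (Suc d) powr - 2)) * ennreal K"
      using weight by (intro mult_mono ennreal_leI) auto
    also have "\<dots> =
        ennreal (K * w) * ennreal (real a powr - 2) * ennreal (real (0 + 1 + d) powr - 2)"
      using K_nonneg by (simp flip: ennreal_mult add: w_def mult_ac)
    finally show ?thesis .
  qed
  have "hcontent s (tail_set N m b) \<le>
      (\<Sum>k. \<Sum>d. ennreal (AP_weight s n (b + 1 + k) d) * hcontent s (tail_set N (m + n) b))"
    using s_pos n by (intro hcontent_tail_set_AP_le) auto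
  also have "\<dots> \<le> (\<Sum>k. \<Sum>d. ennreal (K * w) * ennreal (real (b + 1 + k) powr - 2)
      * ennreal (real (0 + 1 + d) powr - 2))"
    by (intro suminf_le summand) auto
  also have "\<dots> = ennreal (K * w) * (zeta_tail 2 b * zeta_tail 2 0)"
    unfolding zeta_tail_def by (simp add: mult.assoc)
  also have "\<dots> \<le> ennreal (K * w) * (zeta_tail 2 P * zeta_tail 2 0)"
    using b_ge by (intro mult_left_mono mult_right_mono zeta_tail_antimono) auto
  also have "\<dots> \<le> ennreal (K * w) * ennreal (1 / 2)" using P_large(2) by (rule mult_left_mono) simp
  also have "\<dots> = ennreal (K / 2 * w)"
    using K_nonneg by (subst ennreal_mult[symmetric]) (auto simp: w_def)
  finally show ?thesis by (simp add: w_def)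
qed

definition block_end :: "nat \<Rightarrow> nat" where
  "block_end n = \<sigma> n - 1 + n"

lemma hcontent_tail_set_stage_le:
  assumes s_pos: "s > 0" and \<tau>_nonneg: "\<tau> \<ge> 0" and r_large: "s * real r \<ge> 2"
    and n: "1 \<le> n" "N \<le> n" "r \<le> n"
    and free: "\<tau> * (real (gap n) - real n) \<le> 2 * s * (real (gap n) - real r)"
    and P_large: "P \<ge> 1" "zeta_tail \<tau> P \<le> 1" "zeta_tail 2 P * zeta_tail 2 0 \<le> ennreal (1 / 2)"
    and K_nonneg: "K \<ge> 0" and bound: "hcontent s (tail_set N (block_end (Suc n)) P) \<le> ennreal K"
  shows "hcontent s (tail_set N (block_end n) P) \<le> ennreal (K / 2)"
proof -
  define m where "m = \<sigma> (Suc n) - 1"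
  define g where "g = gap n - n"
  define \<kappa> where "\<kappa> = 2 * s * real (Suc n - r)"
  have m: "\<sigma> (Suc n) = Suc m" "block_end n + g = m" "block_end (Suc n) = m + Suc n"
    using le_gap[OF n(1)] sigma_Suc[OF n(1)] pos[OF n(1)] by (auto simp: m_def g_def block_end_def)
  have \<kappa>_nonneg: "\<kappa> \<ge> 0" using s_pos by (simp add: \<kappa>_def)
  have gap_eq: "real (gap n) = real g + real n" using le_gap[OF n(1)] by (simp add: g_def)
  have exponent: "\<kappa> + real g * (2 * s - \<tau>) \<ge> 0"
    using free n s_pos unfolding gap_eq by (simp add: \<kappa>_def of_nat_diff algebra_simps)
  have "hcontent s (tail_set N m b) \<le> ennreal (K / 2 * real b powr - \<kappa>)" if "b \<ge> P" for b
    unfolding \<kappa>_def using n bound m s_pos r_large P_large K_nonneg that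
    by (intro hcontent_tail_set_AP_powr_le) auto
  then have "hcontent s (tail_set N (block_end n) P)
      \<le> ennreal (K / 2 * real P powr - (\<kappa> + real g * (2 * s - \<tau>)))"
    using K_nonneg m
    by (intro hcontent_tail_set_free_digits_powr_le[OF s_pos \<tau>_nonneg P_large(1,2) _
      \<kappa>_nonneg exponent]) auto
  also have "\<dots> \<le> ennreal (K / 2 * 1)"
    using P_large K_nonneg exponent powr_mono[of "- (\<kappa> + real g * (2 * s - \<tau>))" 0 "real P"]
    by (intro ennreal_leI mult_left_mono) auto
  finally show ?thesis by simp
qed

lemma hcontent_tail_set_null:
  assumes s_pos: "s > 0" and \<tau>_nonneg: "\<tau> \<ge> 0" and r_large: "s * real r \<ge> 2" and N: "1 \<le> N" "r \<le> N"
    and free: "\<And>n. n \<ge> N \<Longrightarrow> \<tau> * (real (gap n) - real n) \<le> 2 * s * (real (gap n) - real r)"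
    and P_large: "P \<ge> 1" "zeta_tail \<tau> P \<le> 1" "zeta_tail 2 P * zeta_tail 2 0 \<le> ennreal (1 / 2)"
  shows "hcontent s (tail_set N (block_end N) P) = 0"
proof -
  have "hcontent s (tail_set N (block_end n) P) \<le> ennreal ((1 / 2) ^ k)" if "N \<le> n" for n k
    using that
  proof (induction k arbitrary: n)
    case 0
    then show ?case using hcontent_tail_set_le_1[OF s_pos] by simp
  next
    case (Suc k)
    then have "hcontent s (tail_set N (block_end n) P) \<le> ennreal ((1 / 2) ^ k / 2)"
      using N free[of n]
      by (intro hcontent_tail_set_stage_le[OF s_pos \<tau>_nonneg r_large _ _ _ _ P_large]) auto
    then show ?case by simp
  qed
  moreover have "(\<lambda>k. ennreal ((1 / 2) ^ k)) \<longlonglongrightarrow> ennreal 0"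
    by (intro tendsto_ennrealI LIMSEQ_power_zero) simp
  ultimately have "hcontent s (tail_set N (block_end N) P) \<le> ennreal 0"
    by (intro LIMSEQ_le_const) auto
  then show ?thesis by simp
qed

lemma G_set_gauss_map_funpow_tail_set:
  assumes "x \<in> G_set \<sigma>" and "P \<le> N0"
  obtains n where "N0 \<le> n" "(gauss_map ^^ block_end n) x \<in> tail_set n (block_end n) P"
proof -
  obtain N where N: "\<And>n. n \<ge> N \<Longrightarrow> digits_AP x (\<sigma> n - 1) n" and in_J: "x \<in> J_set"
    using assms(1) by (auto simp: G_set_eq)
  define n where "n = max N0 N"
  define m where "m = block_end n"
  have "P \<le> m" using assms(2) by (simp add: m_def n_def block_end_def)
  then have "P < cf_digit ((gauss_map ^^ m) x) 0"
    using J_set_cf_digit_gt[OF in_J, of m] by (simp add: cf_digit_gauss_map_funpow)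
  moreover have "digits_AP ((gauss_map ^^ m) x) (\<sigma> k - Suc m) k" if "k \<ge> n" "m < \<sigma> k" for k
    using N[of k] that by (simp add: n_def digits_AP_gauss_map_funpow)
  ultimately have "(gauss_map ^^ m) x \<in> tail_set n m P"
    by (simp add: tail_set_def J_set_gauss_map_funpow in_J)
  then show ?thesis using that[of n] by (simp add: m_def n_def)
qed

lemma hcontent_G_set_null:
  assumes s_pos: "s > 0" and \<tau>_gt_1: "\<tau> > 1"
    and free: "\<And>r. \<forall>\<^sub>F n in sequentially.
      \<tau> * (real (gap n) - real n) \<le> 2 * s * (real (gap n) - real r)"
  shows "hcontent s (G_set \<sigma>) = 0"
proof -
  obtain r where r_large: "s * real r \<ge> 2"
    using reals_Archimedean3[OF s_pos] by (metis less_imp_le mult.commute)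
  obtain P where P_large: "P \<ge> 1" "zeta_tail \<tau> P \<le> 1"
      "zeta_tail 2 P * zeta_tail 2 0 \<le> ennreal (1 / 2)"
    using \<tau>_gt_1 by (rule zeta_tail_threshold)
  have "\<forall>\<^sub>F n in sequentially. n \<ge> max r P \<and>
      \<tau> * (real (gap n) - real n) \<le> 2 * s * (real (gap n) - real r)"
    using free[of r] eventually_ge_at_top[of "max r P"] by eventually_elim auto
  then obtain N0 where N0: "\<And>n. n \<ge> N0 \<Longrightarrow> n \<ge> max r P \<and>
      \<tau> * (real (gap n) - real n) \<le> 2 * s * (real (gap n) - real r)"
    unfolding eventually_sequentially by blast
  let ?E = "\<lambda>n. {x \<in> irr01. (gauss_map ^^ block_end n) x \<in> tail_set n (block_end n) P}"
  have "hcontent s (?E (N0 + k)) = 0" for k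
  proof (intro hcontent_gauss_map_preimage_null[OF s_pos]
      hcontent_tail_set_null[OF s_pos _ r_large _ _ _ P_large])
    show "1 \<le> N0 + k" "r \<le> N0 + k" "\<tau> \<ge> 0" using N0[of "N0 + k"] P_large(1) \<tau>_gt_1 by auto
    show "\<tau> * (real (gap n) - real n) \<le> 2 * s * (real (gap n) - real r)" if "n \<ge> N0 + k" for n
      using N0[of n] that by simp
  qed
  then have "hcontent s (\<Union>k. ?E (N0 + k)) = 0" by (rule hcontent_UN_null)
  moreover have "G_set \<sigma> \<subseteq> (\<Union>k. ?E (N0 + k))"
  proof
    fix x assume x: "x \<in> G_set \<sigma>"
    moreover have "P \<le> N0" using N0[of N0] by simp
    ultimately obtain n
      where n: "N0 \<le> n" "(gauss_map ^^ block_end n) x \<in> tail_set n (block_end n) P"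
      by (rule G_set_gauss_map_funpow_tail_set)
    moreover obtain k where "n = N0 + k" using n(1) by (rule le_Suc_ex[THEN exE])
    moreover have "x \<in> irr01" using x by (auto simp: G_set_eq J_set_eq)
    ultimately show "x \<in> (\<Union>k. ?E (N0 + k))" by blast
  qed
  ultimately show ?thesis by (rule hcontent_null_subset)
qed

end

section \<open>Real numbers with prescribed partial quotients\<close>

lemma gauss_map_funpow_eq_0_rat:
  "p > 0 \<Longrightarrow> \<exists>n. (gauss_map ^^ n) (real p / real q) = 0"
proof (induction p arbitrary: q rule: less_induct)
  case (less p)
  have "real q = real (q div p) * real p + real (q mod p)" by (simp flip: of_nat_mult of_nat_add)
  then have "real q / real p - real (q div p) = real (q mod p) / real p"
    using less.prems by (simp add: field_simps)
  then have step: "gauss_map (real p / real q) = real (q mod p) / real p"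
    by (simp add: gauss_map_def frac_def floor_divide_of_nat_eq)
  show ?case
  proof (cases "q mod p = 0")
    case True
    then have "(gauss_map ^^ 1) (real p / real q) = 0" using step by simp
    then show ?thesis by blast
  next
    case False
    then obtain n where "(gauss_map ^^ n) (real (q mod p) / real p) = 0"
      using less.IH[of "q mod p" p] less.prems by auto
    then have "(gauss_map ^^ Suc n) (real p / real q) = 0"
      by (simp del: funpow.simps add: funpow_Suc_right step)
    then show ?thesis by blast
  qed
qed

lemma irrational_if_gauss_map_funpow_pos:
  assumes "\<And>n. (gauss_map ^^ n) x > 0" shows "x \<notin> \<rat>"
proof
  assume "x \<in> \<rat>"
  then obtain p q where "q \<noteq> 0" "\<bar>x\<bar> = real p / real q" by (rule Rats_abs_nat_div_natE)
  moreover have "x > 0" using assms[of 0] by simp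
  ultimately have "x = real p / real q" "p > 0" by (auto intro: Nat.gr0I)
  then obtain n where "(gauss_map ^^ n) x = 0" using gauss_map_funpow_eq_0_rat by blast
  then show False using assms[of n] by simp
qed

text \<open>The closed interval of all \<open>1 / (a 0 + 1 / (a 1 + \<dots> 1 / (a (n - 1) + t)))\<close> with \<open>0 \<le> t \<le> 1\<close>.\<close>
fun cf_interval :: "(nat \<Rightarrow> nat) \<Rightarrow> nat \<Rightarrow> real set" where
  "cf_interval a 0 = {0..1}"
| "cf_interval a (Suc n) = (\<lambda>t. 1 / (real (a 0) + t)) ` cf_interval (a \<circ> Suc) n"

lemma cf_interval_subset:
  assumes "\<And>i. 1 \<le> a i" shows "cf_interval a n \<subseteq> {0..1}"
  using assms
proof (induction n arbitrary: a)
  case (Suc n)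
  then have "cf_interval (a \<circ> Suc) n \<subseteq> {0..1}" by simp
  then show ?case using Suc.prems[of 0] by (auto simp: divide_simps)
qed simp

lemma cf_interval_nonempty: "cf_interval a n \<noteq> {}"
  by (induction n arbitrary: a) auto

lemma compact_cf_interval:
  assumes "\<And>i. 1 \<le> a i" shows "compact (cf_interval a n)"
  using assms
proof (induction n arbitrary: a)
  case (Suc n)
  have "continuous_on (cf_interval (a \<circ> Suc) n) (\<lambda>t. 1 / (real (a 0) + t))"
    using cf_interval_subset[of "a \<circ> Suc" n] Suc.prems[of 0] Suc.prems
    by (intro continuous_intros) fastforce
  then show ?case using Suc by (auto intro: compact_continuous_image)
qed simp

lemma decseq_cf_interval:
  assumes "\<And>i. 1 \<le> a i" shows "decseq (cf_interval a)"
proof (rule decseq_SucI)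
  show "cf_interval a (Suc n) \<subseteq> cf_interval a n" for n
    using assms
  proof (induction n arbitrary: a)
    case 0
    then show ?case using cf_interval_subset[of a 1] by simp
  next
    case (Suc n)
    then have "cf_interval (a \<circ> Suc) (Suc n) \<subseteq> cf_interval (a \<circ> Suc) n" by (intro Suc.IH) simp
    then show ?case by (subst (1 2) cf_interval.simps(2)) (rule image_mono)
  qed
qed

lemma Inter_cf_interval_nonempty:
  assumes "\<And>i. 1 \<le> a i" shows "(\<Inter>n. cf_interval a n) \<noteq> {}"
proof (rule compact_nest)
  show "compact (cf_interval a n)" for n using assms by (rule compact_cf_interval)
  show "m \<le> n \<Longrightarrow> cf_interval a n \<subseteq> cf_interval a m" for m n
    using decseqD[OF decseq_cf_interval[OF assms]] .
qed (rule cf_interval_nonempty)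

lemma Inter_cf_interval_tail:
  assumes "x \<in> (\<Inter>n. cf_interval a n)" shows "1 / x - real (a 0) \<in> (\<Inter>n. cf_interval (a \<circ> Suc) n)"
proof
  fix n
  have "x \<in> cf_interval a (Suc n)" using assms by blast
  then show "1 / x - real (a 0) \<in> cf_interval (a \<circ> Suc) n" by auto
qed

lemma Inter_cf_interval_bounds:
  assumes a: "\<And>i. 1 \<le> a i" and x: "x \<in> (\<Inter>n. cf_interval a n)"
  shows "0 < x" "x < 1"
proof -
  have pos: "0 < y" if "y \<in> cf_interval b (Suc 0)" "1 \<le> b 0" for b y
    using that by (auto intro: add_pos_nonneg)
  have "x \<in> cf_interval a (Suc 0)" using x by blast
  then show "0 < x" using a by (rule pos)
  have "x \<in> cf_interval a (Suc (Suc 0))" using x by blast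
  then obtain t where t_tail: "x = 1 / (real (a 0) + t)" "t \<in> cf_interval (a \<circ> Suc) (Suc 0)"
    unfolding cf_interval.simps(2)[of a] by blast
  have "0 < t" using t_tail(2) a[of 1] by (intro pos) auto
  then show "x < 1" using t_tail(1) a[of 0] by simp
qed

lemma Inter_cf_interval_gauss_map:
  assumes a: "\<And>i. 1 \<le> a i" and x: "x \<in> (\<Inter>n. cf_interval a n)"
  shows "nat \<lfloor>1 / x\<rfloor> = a 0" "gauss_map x \<in> (\<Inter>n. cf_interval (a \<circ> Suc) n)"
proof -
  have tail: "1 / x - real (a 0) \<in> (\<Inter>n. cf_interval (a \<circ> Suc) n)"
    using x by (rule Inter_cf_interval_tail)
  have "1 \<le> (a \<circ> Suc) i" for i using a by simp
  from Inter_cf_interval_bounds[OF this tail]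
  have floor: "\<lfloor>1 / x\<rfloor> = int (a 0)" by (simp add: floor_eq_iff)
  then show "nat \<lfloor>1 / x\<rfloor> = a 0" by simp
  show "gauss_map x \<in> (\<Inter>n. cf_interval (a \<circ> Suc) n)"
    using tail by (simp add: gauss_map_def frac_def floor)
qed

lemma cf_digits_exist:
  assumes a: "\<And>i. 1 \<le> a i" shows "\<exists>x. x \<in> irr01 \<and> cf_digit x = a"
proof -
  obtain x where x: "x \<in> (\<Inter>n. cf_interval a n)" using Inter_cf_interval_nonempty[of a] a by blast
  have orbit: "(gauss_map ^^ k) x \<in> (\<Inter>n. cf_interval (\<lambda>i. a (k + i)) n)" for k
  proof (induction k)
    case (Suc k)
    have "(\<lambda>i. a (k + i)) \<circ> Suc = (\<lambda>i. a (Suc k + i))" by auto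
    then show ?case using Inter_cf_interval_gauss_map(2)[OF a Suc] by simp
  qed (use x in simp)
  have bounds: "0 < (gauss_map ^^ k) x" "(gauss_map ^^ k) x < 1" for k
    using Inter_cf_interval_bounds[OF a orbit] by auto
  have "x \<in> irr01"
    using bounds[of 0] irrational_if_gauss_map_funpow_pos[OF bounds(1)] by (simp add: irr01_def)
  moreover have "cf_digit x k = a k" for k
    using Inter_cf_interval_gauss_map(1)[OF a orbit[of k]] by (simp add: cf_digit_def)
  ultimately show ?thesis by blast
qed

definition cf_of_digits :: "(nat \<Rightarrow> nat) \<Rightarrow> real" where
  "cf_of_digits a = (SOME x. x \<in> irr01 \<and> cf_digit x = a)"

lemma cf_of_digits:
  assumes "\<And>i. 1 \<le> a i"
  shows cf_of_digits_irr01: "cf_of_digits a \<in> irr01"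
    and cf_digit_cf_of_digits: "cf_digit (cf_of_digits a) = a"
  using someI_ex[OF cf_digits_exist[OF assms]] by (auto simp: cf_of_digits_def)

section \<open>Mixed radix digits\<close>

definition mixed_radix_digit :: "(nat \<Rightarrow> nat) \<Rightarrow> real \<Rightarrow> nat \<Rightarrow> nat" where
  "mixed_radix_digit m z n = nat \<lfloor>z * real (\<Prod>i<Suc n. m i)\<rfloor> mod m n"

lemma mixed_radix_digit_less: "1 \<le> m n \<Longrightarrow> mixed_radix_digit m z n < m n"
  by (simp add: mixed_radix_digit_def)

lemma nat_floor_mult_div:
  assumes "x \<ge> 0" "1 \<le> k" shows "nat \<lfloor>x * real k\<rfloor> div k = nat \<lfloor>x\<rfloor>"
proof -
  have "\<lfloor>x * real k / real_of_int (int k)\<rfloor> = \<lfloor>x * real k\<rfloor> div int k"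
    by (rule floor_divide_real_eq_div) simp
  then have "\<lfloor>x\<rfloor> = \<lfloor>x * real k\<rfloor> div int k" using assms by simp
  then show ?thesis
    using assms by (metis nat_div_distrib nat_int of_nat_0_le_iff zero_le_floor mult_nonneg_nonneg)
qed

lemma mixed_radix_digits_agree_floor:
  assumes z: "z \<in> {0..<1}" and w: "w \<in> {0..<1}" and m: "\<And>i. 1 \<le> m i"
    and agree: "\<And>i. i < n \<Longrightarrow> mixed_radix_digit m z i = mixed_radix_digit m w i"
  shows "nat \<lfloor>z * real (\<Prod>i<n. m i)\<rfloor> = nat \<lfloor>w * real (\<Prod>i<n. m i)\<rfloor>"
  using agree
proof (induction n)
  case 0
  have "\<lfloor>z\<rfloor> = 0" "\<lfloor>w\<rfloor> = 0" using z w by (auto simp: floor_eq_iff)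
  then show ?case by simp
next
  case (Suc n)
  let ?f = "\<lambda>y k. nat \<lfloor>y * real (\<Prod>i<k. m i)\<rfloor>"
  have recursion: "?f y (Suc n) = m n * ?f y n + mixed_radix_digit m y n" if "y \<in> {0..<1}" for y
  proof -
    have "y * real (\<Prod>i<n. m i) \<ge> 0" using that by (simp del: of_nat_prod)
    from nat_floor_mult_div[OF this m, of n] have "?f y (Suc n) div m n = ?f y n"
      by (simp add: mult.assoc)
    then show ?thesis
      unfolding mixed_radix_digit_def by (metis mult_div_mod_eq)
  qed
  show ?case using recursion[OF z] recursion[OF w] Suc by simp
qed

lemma mixed_radix_digits_agree_dist:
  assumes z: "z \<in> {0..<1}" and w: "w \<in> {0..<1}" and m: "\<And>i. 1 \<le> m i"
    and agree: "\<And>i. i < n \<Longrightarrow> mixed_radix_digit m z i = mixed_radix_digit m w i"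
  shows "\<bar>z - w\<bar> * real (\<Prod>i<n. m i) \<le> 1"
proof -
  let ?M = "real (\<Prod>i<n. m i)"
  have "z * ?M \<ge> 0" "w * ?M \<ge> 0" using z w by (simp_all del: of_nat_prod)
  then have "\<lfloor>z * ?M\<rfloor> = \<lfloor>w * ?M\<rfloor>"
    using mixed_radix_digits_agree_floor[OF z w m agree, of n] by (simp add: eq_nat_nat_iff)
  then have "\<bar>z * ?M - w * ?M\<bar> \<le> 1" by linarith
  then show ?thesis by (simp add: abs_mult del: of_nat_prod flip: left_diff_distrib)
qed

lemma mixed_radix_first_differing_digit:
  assumes z: "z \<in> {0..<1}" and w: "w \<in> {0..<1}" and "z \<noteq> w" and m: "\<And>i. 1 \<le> m i"
    and unbounded: "filterlim (\<lambda>n. real (\<Prod>i<n. m i)) at_top sequentially"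
  obtains n where "mixed_radix_digit m z n \<noteq> mixed_radix_digit m w n"
    "\<And>i. i < n \<Longrightarrow> mixed_radix_digit m z i = mixed_radix_digit m w i"
proof -
  obtain n where n: "1 / \<bar>z - w\<bar> < real (\<Prod>i<n. m i)"
    using unbounded unfolding filterlim_at_top_dense eventually_sequentially by blast
  then have "\<bar>z - w\<bar> * real (\<Prod>i<n. m i) > 1" using \<open>z \<noteq> w\<close> by (simp add: field_simps)
  then have "\<exists>i. mixed_radix_digit m z i \<noteq> mixed_radix_digit m w i"
    using mixed_radix_digits_agree_dist[OF z w m, of n] by (meson linorder_not_less)
  from LeastI_ex[OF this] that[of "LEAST i. mixed_radix_digit m z i \<noteq> mixed_radix_digit m w i"]
  show ?thesis using not_less_Least by blast
qed

section \<open>Cantor sets of continued fractions\<close>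

locale digit_windows =
  fixes A m :: "nat \<Rightarrow> nat"
  assumes base_ge_1: "1 \<le> A 0" and width_ge_1: "\<And>i. 1 \<le> m i"
    and step: "\<And>i. A i + m i \<le> A (Suc i)"
begin

lemma base_pos: "1 \<le> A i"
proof (induction i)
  case (Suc i)
  then show ?case using step[of i] by linarith
qed (rule base_ge_1)

definition cantor :: "real set" where
  "cantor = {x \<in> irr01. \<forall>i. A i \<le> cf_digit x i \<and> cf_digit x i < A i + m i}"

lemma cantor_subset_irr01: "cantor \<subseteq> irr01"
  by (auto simp: cantor_def)

lemma cantor_subset_J_set: "cantor \<subseteq> J_set"
proof
  fix x assume "x \<in> cantor"
  then have irrational: "x \<in> irr01"
    and window: "\<And>i. A i \<le> cf_digit x i" "\<And>i. cf_digit x i < A i + m i"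
    by (auto simp: cantor_def)
  have "cf_digit x i < cf_digit x (Suc i)" for i
    using window(2)[of i] step[of i] window(1)[of "Suc i"] by linarith
  then show "x \<in> J_set" using irrational by (simp add: J_set_eq strict_mono_Suc_iff)
qed

lemma cantor_gauss_map_funpow_ge:
  assumes "x \<in> cantor" shows "1 / real (A i + m i) \<le> (gauss_map ^^ i) x"
proof -
  have "cf_digit x i < A i + m i" using assms by (auto simp: cantor_def)
  then have "real (cf_digit x i) + 1 \<le> real (A i + m i)" by linarith
  then have "1 / real (A i + m i) \<le> 1 / (real (cf_digit x i) + 1)" by (intro frac_le) auto
  also have "\<dots> \<le> (gauss_map ^^ i) x"
    using assms cantor_subset_irr01 by (intro gauss_map_funpow_ge) auto
  finally show ?thesis .
qed

lemma cantor_gauss_map_funpow_Suc_le: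
  assumes "x \<in> cantor" shows "(gauss_map ^^ Suc i) x \<le> 1 / 2"
proof -
  have "(gauss_map ^^ Suc i) x \<le> 1 / real (cf_digit x (Suc i))"
    using assms cantor_subset_irr01 by (intro gauss_map_funpow_le) auto
  also have "\<dots> \<le> 1 / 2"
    using J_set_cf_digit_gt[of x "Suc i"] assms cantor_subset_J_set by (intro divide_left_mono) auto
  finally show ?thesis .
qed

lemma cantor_inverse_dist_ge:
  assumes x: "x \<in> cantor" and y: "y \<in> cantor" and differ: "cf_digit x n \<noteq> cf_digit y n"
  shows "1 / 2 \<le> \<bar>1 / (gauss_map ^^ n) x - 1 / (gauss_map ^^ n) y\<bar>"
proof -
  have irrational: "x \<in> irr01" "y \<in> irr01" using x y cantor_subset_irr01 by auto
  note pos = irrational[THEN gauss_map_funpow_irr01, THEN irr01_bounds(1), of "Suc n"]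
  have "\<bar>real (cf_digit x n) - real (cf_digit y n)\<bar> \<ge> 1" using differ by linarith
  then show ?thesis
    using pos cantor_gauss_map_funpow_Suc_le[OF x, of n] cantor_gauss_map_funpow_Suc_le[OF y, of n]
    unfolding one_div_gauss_map_funpow[OF irrational(1)] one_div_gauss_map_funpow[OF irrational(2)]
    by linarith
qed

lemma cantor_separated:
  assumes x: "x \<in> cantor" and y: "y \<in> cantor"
    and agree: "\<And>i. i < n \<Longrightarrow> cf_digit x i = cf_digit y i" and differ: "cf_digit x n \<noteq> cf_digit y n"
  shows "1 / real (\<Prod>i<Suc n. A i + m i) ^ 2 \<le> 2 * \<bar>x - y\<bar>"
proof -
  let ?w = "\<lambda>i. (gauss_map ^^ i) x * (gauss_map ^^ i) y"
  have irrational: "x \<in> irr01" "y \<in> irr01" using x y cantor_subset_irr01 by auto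
  note nonneg = irrational[THEN gauss_map_funpow_irr01, THEN irr01_bounds(1), THEN less_imp_le]
  define u v where "u = (gauss_map ^^ n) x" and "v = (gauss_map ^^ n) y"
  have uv: "u > 0" "v > 0"
    unfolding u_def v_def using irrational by (auto intro: irr01_bounds gauss_map_funpow_irr01)
  have "1 / 2 \<le> \<bar>1 / u - 1 / v\<bar>"
    unfolding u_def v_def using x y differ by (rule cantor_inverse_dist_ge)
  also have "1 / u - 1 / v = (v - u) / (u * v)" using uv by (simp add: field_simps)
  finally have "u * v \<le> 2 * \<bar>u - v\<bar>" using uv by (simp add: abs_mult abs_minus_commute field_simps)
  then have "(\<Prod>i<n. ?w i) * (u * v) \<le> (\<Prod>i<n. ?w i) * (2 * \<bar>u - v\<bar>)"
    using nonneg by (intro mult_left_mono prod_nonneg) auto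
  also have "\<dots> = 2 * \<bar>x - y\<bar>"
    using gauss_map_funpow_dist[OF irrational agree, of n] by (simp add: u_def v_def)
  finally have "(\<Prod>i<Suc n. ?w i) \<le> 2 * \<bar>x - y\<bar>" by (simp add: u_def v_def)
  moreover have "(\<Prod>i<Suc n. 1 / real (A i + m i) * (1 / real (A i + m i))) \<le> (\<Prod>i<Suc n. ?w i)"
    using nonneg by (intro prod_mono conjI mult_mono cantor_gauss_map_funpow_ge x y) auto
  moreover have "(\<Prod>i<Suc n. 1 / real (A i + m i) * (1 / real (A i + m i)))
      = 1 / real (\<Prod>i<Suc n. A i + m i) ^ 2"
    by (simp only: prod.distrib prod_dividef of_nat_prod power2_eq_square) simp
  ultimately show ?thesis by linarith
qed

definition coding :: "real \<Rightarrow> real" where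
  "coding z = cf_of_digits (\<lambda>i. A i + mixed_radix_digit m z i)"

lemma coding_irr01: "coding z \<in> irr01"
  unfolding coding_def by (intro cf_of_digits_irr01 trans_le_add1 base_pos)

lemma cf_digit_coding: "cf_digit (coding z) i = A i + mixed_radix_digit m z i"
proof -
  have "cf_digit (coding z) = (\<lambda>i. A i + mixed_radix_digit m z i)"
    unfolding coding_def by (intro cf_digit_cf_of_digits trans_le_add1 base_pos)
  then show ?thesis by simp
qed

lemma coding_in_cantor: "coding z \<in> cantor"
  by (auto simp: cantor_def coding_irr01 cf_digit_coding intro: mixed_radix_digit_less width_ge_1)

lemma prod_window_end_ge: "2 ^ n \<le> (\<Prod>i<n. A i + m i)"
proof -
  have "(\<Prod>i<n. 2) \<le> (\<Prod>i<n. A i + m i)"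
    using base_pos width_ge_1 by (intro prod_mono) (metis add_mono one_add_one zero_le)
  then show ?thesis by simp
qed

lemma prod_window_end_pos: "0 < real (\<Prod>i<n. A i + m i)"
proof -
  have "0 < (\<Prod>i<n. A i + m i)"
    using prod_window_end_ge[of n] by (rule less_le_trans[rotated]) simp
  then show ?thesis by (simp only: of_nat_0_less_iff)
qed

lemma prod_width_at_top:
  assumes s_pos: "s > 0" and C_pos: "C > 0"
    and bound: "\<And>n. real (\<Prod>i<Suc n. A i + m i) powr (2 * s) \<le> C * real (\<Prod>i<n. m i)"
  shows "filterlim (\<lambda>n. real (\<Prod>i<n. m i)) at_top sequentially"
proof (rule filterlim_at_top_mono)
  show "filterlim (\<lambda>n. (2 ^ n) powr (2 * s) / C :: real) at_top sequentially"
    using s_pos C_pos by real_asymp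
  show "\<forall>\<^sub>F n in sequentially. (2 ^ n) powr (2 * s) / C \<le> real (\<Prod>i<n. m i)"
  proof (rule always_eventually, rule allI)
    fix n
    have "2 ^ n \<le> (\<Prod>i<Suc n. A i + m i)"
      using prod_window_end_ge[of "Suc n"] by (simp del: prod.lessThan_Suc)
    then have "real (2 ^ n) \<le> real (\<Prod>i<Suc n. A i + m i)" by (simp only: of_nat_le_iff)
    then have "(2 ^ n) powr (2 * s) \<le> real (\<Prod>i<Suc n. A i + m i) powr (2 * s)"
      using s_pos by (intro powr_mono2) auto
    then show "(2 ^ n) powr (2 * s) / C \<le> real (\<Prod>i<n. m i)"
      using bound[of n] C_pos by (simp add: field_simps del: prod.lessThan_Suc)
  qed
qed

lemma coding_inverse_holder:
  assumes s_pos: "s > 0" and C_pos: "C > 0"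
    and bound: "\<And>n. real (\<Prod>i<Suc n. A i + m i) powr (2 * s) \<le> C * real (\<Prod>i<n. m i)"
    and z: "z \<in> {0..<1}" and w: "w \<in> {0..<1}"
  shows "\<bar>z - w\<bar> \<le> C * 2 powr s * \<bar>coding z - coding w\<bar> powr s"
proof (cases "z = w")
  case False
  then obtain n where n: "mixed_radix_digit m z n \<noteq> mixed_radix_digit m w n"
    "\<And>i. i < n \<Longrightarrow> mixed_radix_digit m z i = mixed_radix_digit m w i"
    using prod_width_at_top[OF s_pos C_pos bound]
    by (rule mixed_radix_first_differing_digit[OF z w _ width_ge_1]) blast
  define Q where "Q = real (\<Prod>i<Suc n. A i + m i)"
  have Q_pos: "Q > 0" unfolding Q_def by (rule prod_window_end_pos)
  have "\<bar>z - w\<bar> * Q powr (2 * s) \<le> \<bar>z - w\<bar> * (C * real (\<Prod>i<n. m i))"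
    unfolding Q_def by (intro mult_left_mono bound) auto
  also have "\<dots> = C * (\<bar>z - w\<bar> * real (\<Prod>i<n. m i))" by (simp only: mult_ac)
  also have "\<dots> \<le> C * 1"
    using C_pos mixed_radix_digits_agree_dist[OF z w width_ge_1 n(2)] by (intro mult_left_mono) auto
  finally have "\<bar>z - w\<bar> \<le> C * (1 / Q ^ 2) powr s"
    using Q_pos by (simp add: powr_divide powr_powr field_simps flip: powr_numeral)
  also have "\<dots> \<le> C * (2 * \<bar>coding z - coding w\<bar>) powr s"
    unfolding Q_def using n s_pos C_pos
    by (intro mult_left_mono powr_mono2 cantor_separated coding_in_cantor)
      (auto simp: cf_digit_coding)
  finally show ?thesis by (simp add: powr_mult mult.assoc)
qed simp

lemma hcontent_cantor_nonzero:
  assumes s_pos: "s > 0" and C_pos: "C > 0"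
    and bound: "\<And>n. real (\<Prod>i<Suc n. A i + m i) powr (2 * s) \<le> C * real (\<Prod>i<n. m i)"
  shows "hcontent s cantor \<noteq> 0"
proof
  assume null: "hcontent s cantor = 0"
  have "hcontent 1 {0..<1::real} \<le> ennreal ((C * 2 powr s) powr 1) * hcontent (s * 1) cantor"
    using s_pos C_pos coding_in_cantor coding_inverse_holder[OF s_pos C_pos bound]
    by (intro hcontent_inverse_holder[where g = coding]) (auto simp: dist_real_def)
  then have "hcontent 1 {0..<1::real} = 0" using null by simp
  then show False using emeasure_lborel_le_hcontent[of "{0..<1}"] by simp
qed

end

section \<open>The lower bound\<close>

lemma sum_le_telescope_plus_const:
  fixes a b :: "nat \<Rightarrow> real"
  assumes "\<forall>\<^sub>F j in sequentially. a j \<le> b (Suc j) - b j"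
  obtains C where "C \<ge> 0" "\<And>k. sum a {..<k} \<le> b k + C"
proof -
  obtain N where N: "\<And>j. j \<ge> N \<Longrightarrow> a j \<le> b (Suc j) - b j"
    using assms unfolding eventually_sequentially by blast
  define S where "S k = sum a {..<k} - b k" for k
  define C where "C = max 0 (Max (S ` {..N}))"
  have initial: "S k \<le> C" if "k \<le> N" for k
    using that by (auto simp: C_def intro!: max.coboundedI2 Max_ge)
  have "S k \<le> C" for k
  proof (cases "k \<le> N")
    case False
    then have "N \<le> k" by simp
    then show ?thesis
    proof (induction k rule: dec_induct)
      case (step k)
      then show ?case using N[of k] by (simp add: S_def)
    qed (simp add: initial)
  qed (rule initial)
  then show ?thesis using that[of C] by (simp add: S_def C_def algebra_simps)
qed

lemma eventually_less_if_tendsto_less: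
  fixes l m :: "'a::{linorder_topology, dense_order}"
  assumes f: "(f \<longlongrightarrow> l) F" and g: "(g \<longlongrightarrow> m) F" and "l < m"
  shows "\<forall>\<^sub>F x in F. f x < g x"
proof -
  obtain c where c: "l < c" "c < m" using dense[OF \<open>l < m\<close>] by blast
  show ?thesis using order_tendstoD(2)[OF f c(1)] order_tendstoD(1)[OF g c(2)]
    by eventually_elim (rule less_trans)
qed

lemma ln_fact_ge:
  assumes "n \<ge> 1" shows "real n * ln (real n) - real n \<le> ln (fact n)"
proof -
  have "real n ^ n / fact n \<le> exp (real n)"
    using sum_le_suminf[OF summable_exp_generic[of "real n"], of "{n}"]
    by (simp add: exp_def scaleR_conv_of_real divide_inverse mult.commute)
  then have "ln (real n ^ n / fact n) \<le> ln (exp (real n))" using assms by (intro ln_mono) auto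
  then show ?thesis using assms by (simp add: ln_div ln_realpow)
qed

lemma eventually_ln_window_bounds_less:
  fixes s l \<theta> c :: real
  assumes "2 * s * l < (l - 1) * (1 - \<theta>)"
  shows "\<forall>\<^sub>F n::nat in sequentially. 2 * s * (l * (real n + 1) * ln (real n + 2))
    < (l - 1) * (real n * ln (real n) - real n - (\<theta> * real n + c) * ln (real n))"
proof -
  define f where "f n = 2 * s * (l * (real n + 1) * ln (real n + 2))" for n :: nat
  define g where "g n = (l - 1) * (real n * ln (real n) - real n - (\<theta> * real n + c) * ln (real n))"
    for n :: nat
  have "(\<lambda>n. f n / (real n * ln (real n))) \<longlonglongrightarrow> 2 * s * l" unfolding f_def by real_asymp
  moreover have "(\<lambda>n. g n / (real n * ln (real n))) \<longlonglongrightarrow> (l - 1) * (1 - \<theta>)"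
    unfolding g_def by real_asymp
  ultimately have "\<forall>\<^sub>F n in sequentially.
      f n / (real n * ln (real n)) < g n / (real n * ln (real n))"
    using assms by (rule eventually_less_if_tendsto_less)
  then have "\<forall>\<^sub>F n in sequentially. f n < g n"
    using eventually_ge_at_top[of 2]
  proof eventually_elim
    case (elim n)
    then have "real n * ln (real n) > 0" by simp
    then show ?case using elim(1) by (simp add: divide_less_cancel)
  qed
  then show ?thesis by (simp only: f_def g_def)
qed

context block_positions
begin

definition in_block :: "nat \<Rightarrow> bool" where
  "in_block i \<longleftrightarrow> (\<exists>n\<ge>1. \<sigma> n \<le> Suc i \<and> Suc i < \<sigma> n + n)"

definition block_step :: "nat \<Rightarrow> bool" where
  "block_step i \<longleftrightarrow> (\<exists>n\<ge>1. \<sigma> n \<le> Suc i \<and> Suc (Suc i) < \<sigma> n + n)"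

lemma block_step_imp_in_block: "block_step i \<Longrightarrow> in_block i"
  by (auto simp: block_step_def in_block_def)

text \<open>A free digit \<open>a\<^sub>j\<close> ranges over the \<open>j ^ (L - 1)\<close> integers from \<open>j ^ L\<close> on, where \<open>j = i + 1\<close>;
  the digits of a block are forced to be consecutive integers.\<close>
primrec digit_base :: "nat \<Rightarrow> nat \<Rightarrow> nat" where
  "digit_base L 0 = 1"
| "digit_base L (Suc i) = (if block_step i then digit_base L i + 1 else (i + 2) ^ L)"

definition digit_width :: "nat \<Rightarrow> nat \<Rightarrow> nat" where
  "digit_width L i = (if in_block i then 1 else (i + 1) ^ (L - 1))"

lemma digit_base_le:
  assumes "1 \<le> L" shows "digit_base L i \<le> (i + 1) ^ L"
proof (induction i)
  case (Suc i)
  have "(i + 1) ^ L + 1 \<le> (i + 2) ^ L"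
    using power_strict_mono[of "i + 1" "i + 2" L] assms by simp
  then show ?case using Suc by simp
qed simp

lemma digit_width_ge_1: "1 \<le> digit_width L i"
  by (simp add: digit_width_def)

lemma prod_width_pos: "0 < real (\<Prod>i<n. digit_width L i)"
  using digit_width_ge_1 by (auto intro!: prod_pos simp: Suc_le_eq)

lemma digit_base_plus_width_le:
  assumes "1 \<le> L" shows "digit_base L i + digit_width L i \<le> (i + 2) ^ L"
proof -
  obtain l where L_Suc: "L = Suc l" using assms by (cases L) auto
  have "digit_width L i \<le> (i + 1) ^ l" by (simp add: digit_width_def L_Suc)
  then have "digit_base L i + digit_width L i \<le> (i + 1) ^ L + (i + 1) ^ l"
    using digit_base_le[OF assms] by (rule add_mono[rotated])
  also have "\<dots> = (i + 2) * (i + 1) ^ l" by (simp add: L_Suc)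
  also have "\<dots> \<le> (i + 2) * (i + 2) ^ l" by (intro mult_left_mono power_mono) auto
  finally show ?thesis by (simp add: L_Suc)
qed

lemma digit_base_step:
  assumes "1 \<le> L" shows "digit_base L i + digit_width L i \<le> digit_base L (Suc i)"
  using digit_base_plus_width_le[OF assms, of i] block_step_imp_in_block[of i]
  by (auto simp: digit_width_def)

lemma digit_windows: "1 \<le> L \<Longrightarrow> digit_windows (digit_base L) (digit_width L)"
  by unfold_locales (use digit_width_ge_1 digit_base_step in auto)

lemma cantor_subset_G_set:
  assumes L_ge_1: "1 \<le> L" shows "digit_windows.cantor (digit_base L) (digit_width L) \<subseteq> G_set \<sigma>"
proof
  interpret digit_windows "digit_base L" "digit_width L" by (rule digit_windows[OF L_ge_1])
  fix x assume x: "x \<in> cantor"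
  have block: "cf_digit x i = digit_base L i" if "in_block i" for i
  proof -
    have "digit_base L i \<le> cf_digit x i" "cf_digit x i < digit_base L i + digit_width L i"
      using x by (auto simp: cantor_def)
    then show ?thesis using that by (simp add: digit_width_def)
  qed
  have "digits_AP x (\<sigma> n - 1) n" if n: "n \<ge> 1" for n
  proof -
    have base: "digit_base L (\<sigma> n - 1 + i) = digit_base L (\<sigma> n - 1) + i" if "i < n" for i
      using that
    proof (induction i)
      case (Suc i)
      then have "block_step (\<sigma> n - 1 + i)"
        using n pos[OF n] unfolding block_step_def by (intro exI[of _ n]) auto
      then show ?case using Suc by simp
    qed simp
    have "in_block (\<sigma> n - 1 + i)" if "i < n" for i
      using n pos[OF n] that unfolding in_block_def by (intro exI[of _ n]) auto
    then have digit: "cf_digit x (\<sigma> n - 1 + i) = digit_base L (\<sigma> n - 1) + i" if "i < n" for i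
      using block base that by metis
    then have "cf_digit x (\<sigma> n - 1 + i) = cf_digit x (\<sigma> n - 1) + i * Suc 0" if "i < n" for i
      using digit[of 0] digit[OF that] n by simp
    then show ?thesis unfolding digits_AP_def by blast
  qed
  then show "x \<in> G_set \<sigma>" using x cantor_subset_J_set by (auto simp: G_set_eq)
qed

lemma ln_prod_window_end_le:
  assumes L_ge_1: "1 \<le> L"
  shows "ln (real (\<Prod>i<Suc n. digit_base L i + digit_width L i))
    \<le> real L * (real n + 1) * ln (real n + 2)"
proof -
  interpret digit_windows "digit_base L" "digit_width L" by (rule digit_windows[OF L_ge_1])
  let ?Q = "\<Prod>i<Suc n. digit_base L i + digit_width L i"
  have "?Q \<le> (\<Prod>i<Suc n. (n + 2) ^ L)"
  proof (intro prod_mono conjI)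
    fix i assume "i \<in> {..<Suc n}"
    then have "(i + 2) ^ L \<le> (n + 2) ^ L" by (intro power_mono) auto
    then show "digit_base L i + digit_width L i \<le> (n + 2) ^ L"
      using digit_base_plus_width_le[OF L_ge_1, of i] by linarith
  qed simp
  also have "\<dots> = (n + 2) ^ (L * (n + 1))"
    by (simp only: prod_constant card_lessThan Suc_eq_plus1 power_mult)
  finally have "real ?Q \<le> real ((n + 2) ^ (L * (n + 1)))" by (simp only: of_nat_le_iff)
  then have "ln (real ?Q) \<le> ln (real ((n + 2) ^ (L * (n + 1))))"
    by (intro ln_mono prod_window_end_pos)
  also have "\<dots> = real (L * (n + 1)) * ln (real (n + 2))"
    by (simp add: ln_realpow del: of_nat_add of_nat_mult)
  finally show ?thesis by (simp add: algebra_simps)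
qed

lemma ln_prod_width_ge:
  assumes L_ge_1: "1 \<le> L" and n: "1 \<le> n"
  shows "(real L - 1) *
      (real n * ln (real n) - real n - real (card {i \<in> {..<n}. in_block i}) * ln (real n))
    \<le> ln (real (\<Prod>i<n. digit_width L i))"
proof -
  define D where "D = card {i \<in> {..<n}. in_block i}"
  define M where "M = (\<Prod>i<n. digit_width L i)"
  have "M \<ge> 1" unfolding M_def by (intro prod_ge_1 digit_width_ge_1)
  have "fact n ^ (L - 1) = (\<Prod>i<n. (i + 1) ^ (L - 1))"
    by (simp add: fact_prod_Suc prod_power_distrib lessThan_atLeast0)
  also have "\<dots> \<le> (\<Prod>i<n. digit_width L i * (if in_block i then n ^ (L - 1) else 1))"
    by (intro prod_mono) (auto simp: digit_width_def intro!: power_mono)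
  also have "\<dots> = M * (n ^ (L - 1)) ^ D"
    by (simp add: prod.distrib M_def D_def prod.If_cases Int_def)
  finally have "real (fact n ^ (L - 1)) \<le> real (M * (n ^ (L - 1)) ^ D)"
    by (simp only: of_nat_le_iff)
  then have "ln ((fact n :: real) ^ (L - 1)) \<le> ln (real M * (real n ^ (L - 1)) ^ D)"
    by (intro ln_mono) auto
  also have "\<dots> = ln (real M) + real D * (real (L - 1) * ln (real n))"
    using n \<open>M \<ge> 1\<close> by (simp add: ln_mult ln_realpow)
  finally have "(real L - 1) * (ln (fact n) - real D * ln (real n)) \<le> ln (real M)"
    using L_ge_1 by (simp add: ln_realpow of_nat_diff algebra_simps)
  moreover have "(real L - 1) * (real n * ln (real n) - real n - real D * ln (real n))
      \<le> (real L - 1) * (ln (fact n) - real D * ln (real n))"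
    using ln_fact_ge[OF n] L_ge_1 by (intro mult_left_mono) auto
  ultimately show ?thesis by (simp add: D_def M_def)
qed

lemma le_sigma: "1 \<le> n \<Longrightarrow> n \<le> \<sigma> n"
proof (induction n rule: dec_induct)
  case base
  then show ?case using pos[of 1] by simp
next
  case (step n)
  then show ?case using gap_ge[of n] by simp
qed

lemma card_in_block_le:
  obtains k where "k = 0 \<or> \<sigma> k \<le> n" "card {i \<in> {..<n}. in_block i} \<le> (\<Sum>j<k. Suc j)"
proof -
  define S where "S = {j \<in> {1..n}. \<sigma> j \<le> n}"
  define k where "k = Max (insert 0 S)"
  have fin: "finite (insert 0 S)" by (simp add: S_def)
  have "{i \<in> {..<n}. in_block i} \<subseteq> (\<Union>j\<in>{1..k}. {\<sigma> j - 1..<\<sigma> j - 1 + j})"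
  proof
    fix i assume "i \<in> {i \<in> {..<n}. in_block i}"
    then obtain j where j: "1 \<le> j" "\<sigma> j \<le> Suc i" "Suc i < \<sigma> j + j" "i < n"
      by (auto simp: in_block_def)
    then have "j \<in> S" using le_sigma[of j] by (auto simp: S_def)
    then have "j \<le> k" using fin by (simp add: k_def)
    then have "j \<in> {1..k}" "i \<in> {\<sigma> j - 1..<\<sigma> j - 1 + j}" using j pos[of j] by auto
    then show "i \<in> (\<Union>j\<in>{1..k}. {\<sigma> j - 1..<\<sigma> j - 1 + j})" by blast
  qed
  then have "card {i \<in> {..<n}. in_block i} \<le> card (\<Union>j\<in>{1..k}. {\<sigma> j - 1..<\<sigma> j - 1 + j})"
    by (intro card_mono) auto
  also have "\<dots> \<le> (\<Sum>j\<in>{1..k}. card {\<sigma> j - 1..<\<sigma> j - 1 + j})" by (intro card_UN_le) simp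
  also have "\<dots> = (\<Sum>j<k. Suc j)" by (simp add: sum.atLeast1_atMost_eq)
  finally have "card {i \<in> {..<n}. in_block i} \<le> (\<Sum>j<k. Suc j)" .
  moreover have "k \<in> insert 0 S" unfolding k_def using fin by (intro Max_in) auto
  ultimately show ?thesis using that[of k] by (auto simp: S_def)
qed

lemma gap_ratio_limit_ge_1:
  assumes "(\<lambda>n. ereal (real (gap n) / real n)) \<longlonglongrightarrow> \<beta>" shows "1 \<le> \<beta>"
proof (rule LIMSEQ_le_const[OF assms], intro exI allI impI)
  fix n :: nat assume "1 \<le> n"
  then show "1 \<le> ereal (real (gap n) / real n)" using le_gap[of n] by (simp add: one_ereal_def)
qed

lemma gap_ratio_inverse_tendsto:
  assumes ratio: "(\<lambda>n. ereal (real (gap n) / real n)) \<longlonglongrightarrow> \<beta>"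
  shows "(\<lambda>n. real n / real (gap n)) \<longlonglongrightarrow> real_of_ereal (1 / \<beta>)"
proof -
  have \<beta>: "1 \<le> \<beta>" using ratio by (rule gap_ratio_limit_ge_1)
  then have "\<beta> \<noteq> 0" by auto
  then have "(\<lambda>n. 1 / ereal (real (gap n) / real n)) \<longlonglongrightarrow> 1 / \<beta>"
    by (rule tendsto_inverse_ereal[OF ratio])
  moreover have "\<forall>\<^sub>F n in sequentially.
      1 / ereal (real (gap n) / real n) = ereal (real n / real (gap n))"
    using eventually_ge_at_top[of 1]
  proof eventually_elim
    case (elim n)
    then have "real (gap n) / real n \<noteq> 0" using le_gap[of n] by simp
    then show ?case by (simp add: one_ereal_def)
  qed
  ultimately have inverse_ratio: "(\<lambda>n. ereal (real n / real (gap n))) \<longlonglongrightarrow> 1 / \<beta>"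
    by (rule Lim_transform_eventually)
  obtain \<theta> where "1 / \<beta> = ereal \<theta>" using \<beta> by (cases \<beta>) (auto simp: one_ereal_def)
  then show ?thesis using inverse_ratio by simp
qed

end

locale block_density = block_positions +
  fixes \<theta> :: real
  assumes density: "(\<lambda>n. real n / real (gap n)) \<longlonglongrightarrow> \<theta>"
begin

lemma density_nonneg: "0 \<le> \<theta>"
  using density by (rule LIMSEQ_le_const) auto

lemma density_le_1: "\<theta> \<le> 1"
proof (rule LIMSEQ_le_const2[OF density], intro exI allI impI)
  fix n :: nat assume "1 \<le> n"
  then show "real n / real (gap n) \<le> 1" using le_gap[of n] by simp
qed

lemma card_in_block_le_density:
  assumes "\<theta> < \<theta>'"
  obtains C where "\<And>n. real (card {i \<in> {..<n}. in_block i}) \<le> \<theta>' * real n + C"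
proof -
  have "(\<lambda>n. real n / real (gap n) * (real (Suc n) / real n)) \<longlonglongrightarrow> \<theta> * 1"
    by (intro tendsto_mult density) real_asymp
  then have "\<forall>\<^sub>F n in sequentially. real n / real (gap n) * (real (Suc n) / real n) < \<theta>'"
    using assms by (intro order_tendstoD) auto
  then have "\<forall>\<^sub>F n in sequentially. real (Suc n) \<le> \<theta>' * real (\<sigma> (Suc n)) - \<theta>' * real (\<sigma> n)"
    using eventually_ge_at_top[of 1]
  proof eventually_elim
    case (elim n)
    then have "real (gap n) > 0" using le_gap[of n] by simp
    moreover have "real (Suc n) / real (gap n) < \<theta>'" using elim by simp
    ultimately have "real (Suc n) \<le> \<theta>' * real (gap n)" by (simp add: field_simps)
    then show ?case using sigma_Suc[OF elim(2)] by (simp add: algebra_simps)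
  qed
  then obtain C where C_bound: "C \<ge> 0" "\<And>k. (\<Sum>j<k. real (Suc j)) \<le> \<theta>' * real (\<sigma> k) + C"
    by (rule sum_le_telescope_plus_const) blast
  have "real (card {i \<in> {..<n}. in_block i}) \<le> \<theta>' * real n + C" for n
  proof -
    obtain k where k: "k = 0 \<or> \<sigma> k \<le> n" "card {i \<in> {..<n}. in_block i} \<le> (\<Sum>j<k. Suc j)"
      by (rule card_in_block_le)
    have "\<theta>' > 0" using assms density_nonneg by simp
    have "(\<Sum>j<k. real (Suc j)) \<le> \<theta>' * real n + C"
    proof (cases "k = 0")
      case False
      with k(1) \<open>\<theta>' > 0\<close> have "\<theta>' * real (\<sigma> k) \<le> \<theta>' * real n" by simp
      then show ?thesis using C_bound(2)[of k] by linarith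
    qed (use C_bound(1) \<open>\<theta>' > 0\<close> in simp)
    moreover have "real (card {i \<in> {..<n}. in_block i}) \<le> (\<Sum>j<k. real (Suc j))"
      using k(2) by (simp only: of_nat_sum[symmetric] of_nat_le_iff)
    ultimately show ?thesis by linarith
  qed
  then show ?thesis by (rule that)
qed

lemma eventually_prod_window_end_powr_le:
  assumes s_pos: "s > 0" and L_ge_1: "1 \<le> L" and "\<theta> < \<theta>'"
    and exponents: "2 * s * real L < (real L - 1) * (1 - \<theta>')"
  shows "\<forall>\<^sub>F n in sequentially. real (\<Prod>i<Suc n. digit_base L i + digit_width L i) powr (2 * s)
    \<le> real (\<Prod>i<n. digit_width L i)"
proof -
  interpret digit_windows "digit_base L" "digit_width L" by (rule digit_windows[OF L_ge_1])
  obtain C where C_bound: "\<And>n. real (card {i \<in> {..<n}. in_block i}) \<le> \<theta>' * real n + C"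
    using \<open>\<theta> < \<theta>'\<close> by (rule card_in_block_le_density) blast
  have "\<forall>\<^sub>F n in sequentially. 2 * s * (real L * (real n + 1) * ln (real n + 2))
      < (real L - 1) * (real n * ln (real n) - real n - (\<theta>' * real n + C) * ln (real n))"
    using exponents by (rule eventually_ln_window_bounds_less)
  then show ?thesis
    using eventually_ge_at_top[of 2]
  proof eventually_elim
    case (elim n)
    define Q where "Q = real (\<Prod>i<Suc n. digit_base L i + digit_width L i)"
    define M where "M = real (\<Prod>i<n. digit_width L i)"
    have "2 * s * ln Q \<le> 2 * s * (real L * (real n + 1) * ln (real n + 2))"
      unfolding Q_def using s_pos ln_prod_window_end_le[OF L_ge_1, of n]
      by (intro mult_left_mono) auto
    moreover have
      "(real L - 1) * (real n * ln (real n) - real n - (\<theta>' * real n + C) * ln (real n)) \<le> ln M"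
      unfolding M_def
    proof (rule order_trans[OF _ ln_prod_width_ge[OF L_ge_1]])
      have "real (card {i \<in> {..<n}. in_block i}) * ln (real n) \<le> (\<theta>' * real n + C) * ln (real n)"
        using C_bound[of n] elim(2) by (intro mult_right_mono) auto
      then show "(real L - 1) * (real n * ln (real n) - real n - (\<theta>' * real n + C) * ln (real n))
          \<le> (real L - 1) *
            (real n * ln (real n) - real n - real (card {i \<in> {..<n}. in_block i}) * ln (real n))"
        using L_ge_1 by (intro mult_left_mono) auto
    qed (use elim(2) in simp)
    ultimately have "exp (2 * s * ln Q) \<le> exp (ln M)" using elim(1) by simp
    moreover have "Q > 0" unfolding Q_def by (rule prod_window_end_pos)
    moreover have "M > 0" unfolding M_def by (rule prod_width_pos)
    ultimately have "Q powr (2 * s) \<le> M" by (simp add: powr_def)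
    then show ?case by (simp only: Q_def M_def)
  qed
qed

lemma hcontent_G_set_nonzero_below_dim:
  assumes s_pos: "s > 0" and "2 * s < 1 - \<theta>" shows "hcontent s (G_set \<sigma>) \<noteq> 0"
proof -
  obtain \<theta>' where \<theta>': "\<theta> < \<theta>'" "\<theta>' < 1 - 2 * s" using dense[of \<theta> "1 - 2 * s"] assms(2) by auto
  obtain L where "1 - \<theta>' < real L * (1 - \<theta>' - 2 * s)"
    using reals_Archimedean3[of "1 - \<theta>' - 2 * s"] \<theta>'(2) by auto
  then have exponents: "2 * s * real L < (real L - 1) * (1 - \<theta>')" by (simp add: algebra_simps)
  have L_ge_1: "1 \<le> L" using exponents \<theta>' s_pos by (cases L) auto
  interpret digit_windows "digit_base L" "digit_width L" by (rule digit_windows[OF L_ge_1])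
  let ?Q = "\<lambda>n. real (\<Prod>i<Suc n. digit_base L i + digit_width L i)"
  let ?M = "\<lambda>n. real (\<Prod>i<n. digit_width L i)"
  have M_pos: "?M n > 0" for n by (rule prod_width_pos)
  have "\<forall>\<^sub>F n in sequentially. norm (?Q n powr (2 * s) / ?M n) \<le> norm (1::real)"
    using eventually_prod_window_end_powr_le[OF s_pos L_ge_1 \<theta>'(1) exponents]
    by eventually_elim (use M_pos in \<open>simp del: prod.lessThan_Suc of_nat_prod\<close>)
  then have "Bseq (\<lambda>n. ?Q n powr (2 * s) / ?M n)" by (rule Bseq_eventually_mono) (rule Bfun_const)
  then obtain C where C_bound: "C > 0" "\<And>n. norm (?Q n powr (2 * s) / ?M n) \<le> C"
    by (rule BseqE) blast
  have "?Q n powr (2 * s) \<le> C * ?M n" for n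
    using C_bound(2)[of n] M_pos[of n] by (simp add: field_simps del: prod.lessThan_Suc of_nat_prod)
  then have "hcontent s cantor \<noteq> 0" by (rule hcontent_cantor_nonzero[OF s_pos C_bound(1)])
  then show ?thesis using hcontent_null_subset cantor_subset_G_set[OF L_ge_1] by blast
qed

section \<open>The dimension\<close>

lemma hcontent_G_set_null_above_dim:
  assumes s_large: "(1 - \<theta>) / 2 < s" shows "hcontent s (G_set \<sigma>) = 0"
proof -
  define \<tau> where "\<tau> = 1 + (2 * s - (1 - \<theta>)) / 2"
  have \<tau>_gt_1: "\<tau> > 1" using s_large by (simp add: \<tau>_def)
  have "(\<tau> - 1) * (1 - \<theta>) \<le> (\<tau> - 1) * 1" using \<tau>_gt_1 density_nonneg by (intro mult_left_mono) auto
  then have "\<tau> * (1 - \<theta>) < 2 * s" using s_large by (simp add: \<tau>_def field_simps)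
  show ?thesis
  proof (rule hcontent_G_set_null[OF _ \<tau>_gt_1])
    show "s > 0" using s_large density_le_1 by simp
    fix r :: nat
    have "(\<lambda>n. \<tau> * (1 - real n / real (gap n))) \<longlonglongrightarrow> \<tau> * (1 - \<theta>)"
      by (intro tendsto_intros density)
    moreover have "(\<lambda>n. 2 * s * (1 - real r / real n * (real n / real (gap n))))
        \<longlonglongrightarrow> 2 * s * (1 - 0 * \<theta>)"
      by (intro tendsto_intros density lim_const_over_n)
    ultimately have "\<forall>\<^sub>F n in sequentially. \<tau> * (1 - real n / real (gap n))
        < 2 * s * (1 - real r / real n * (real n / real (gap n)))"
      using \<open>\<tau> * (1 - \<theta>) < 2 * s\<close> by (intro eventually_less_if_tendsto_less) auto
    then show "\<forall>\<^sub>F n in sequentially. \<tau> * (real (gap n) - real n) \<le> 2 * s * (real (gap n) - real r)"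
      using eventually_ge_at_top[of 1]
    proof eventually_elim
      case (elim n)
      then have "real (gap n) > 0" using le_gap[of n] by simp
      moreover have "\<tau> * (1 - real n / real (gap n)) < 2 * s * (1 - real r / real (gap n))"
        using elim by simp
      ultimately have "\<tau> * (1 - real n / real (gap n)) * real (gap n)
          < 2 * s * (1 - real r / real (gap n)) * real (gap n)" by (intro mult_strict_right_mono)
      moreover have "(1 - real k / real (gap n)) * real (gap n) = real (gap n) - real k" for k
        using \<open>real (gap n) > 0\<close> by (simp add: left_diff_distrib)
      ultimately show ?case by (simp only: mult.assoc less_imp_le)
    qed
  qed
qed

theorem hausdorff_dim_G_set: "hausdorff_dim (G_set \<sigma>) = (1 - \<theta>) / 2"
  using density_le_1 hcontent_G_set_null_above_dim hcontent_G_set_nonzero_below_dim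
  by (intro hausdorff_dim_eqI) auto

end

theorem theorem1p2:
  fixes \<sigma> :: "nat \<Rightarrow> nat" and \<beta> :: ereal
  assumes pos: "\<forall>n\<ge>1. 0 < \<sigma> n"
    and incr: "\<forall>n\<ge>1. \<sigma> n < \<sigma> (Suc n)"
    and gap: "\<forall>n\<ge>1. \<sigma> (Suc n) \<ge> \<sigma> n + n"
    and lim: "(\<lambda>n. ereal ((real (\<sigma> (Suc n)) - real (\<sigma> n)) / real n)) \<longlonglongrightarrow> \<beta>"
  shows "hausdorff_dim (G_set \<sigma>) =
           (if \<beta> = \<infinity> then 1 / 2 else (real_of_ereal \<beta> - 1) / (2 * real_of_ereal \<beta>))"
proof -
  interpret block_positions \<sigma> using pos gap by unfold_locales auto
  have "\<forall>\<^sub>F n in sequentially.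
      ereal ((real (\<sigma> (Suc n)) - real (\<sigma> n)) / real n) = ereal (real (gap n) / real n)"
    using eventually_ge_at_top[of 1] by eventually_elim (simp add: sigma_Suc)
  with lim have ratio: "(\<lambda>n. ereal (real (gap n) / real n)) \<longlonglongrightarrow> \<beta>" by (rule Lim_transform_eventually)
  interpret block_density \<sigma> "real_of_ereal (1 / \<beta>)"
    by unfold_locales (rule gap_ratio_inverse_tendsto[OF ratio])
  show ?thesis
    using hausdorff_dim_G_set gap_ratio_limit_ge_1[OF ratio]
    by (cases \<beta>) (auto simp: field_simps one_ereal_def)
qed

end
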